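(* Let $\Gamma$ be a countably infinite (discrete) group and let $\Gamma\curvearrowright X$ be a distal continuous action on a compact metrizable space $X$. Then the naive topological entropy satisfies $h^{\rm nv}(\Gamma\curvearrowright X)=0$. Moreover, if $\mu$ is a $\Gamma$-invariant Borel probability measure on $X$, then the measure-preserving action $\Gamma\curvearrowright(X,\mu)$ has zero naive entropy, i.e. $h^{\rm nv}_\mu(\Gamma\curvearrowright X)=0$.
   Context: Distal: the action is distal if for any distinct $x,y\in X$ one has $\inf_{s\in\Gamma}\rho(sx,sy)>0$, where $\rho$ is any given compatible metric on $X$. Naive topological entropy: for a finite open cover $\mathcal U$ of $X$, $N(\mathcal U)$ is the minimal cardinality of subcovers of $\mathcal U$. For covers $\mathcal U,\mathcal V$, $\mathcal U\vee\mathcal V=\{U\cap V: U\in\mathcal U, V\in\mathcal V\}$. For a nonempty finite $F\subseteq\Gamma$, $\mathcal U^F=\bigvee_{s\in F}s^{-1}\mathcal U$. Set $h^{\rm nv}(\Gamma,\mathcal U)=\inf_F\frac{1}{|F|}\log N(\mathcal U^F)$, with $F$ ranging over nonempty finite subsets of $\Gamma$, and $h^{\rm nv}(\Gamma\curvearrowright X)=\sup_{\mathcal U}h^{\rm nv}(\Gamma,\mathcal U)$, with $\mathcal U$ ranging over finite open covers of $X$. Naive measure entropy: $h^{\rm nv}_\mu(\Gamma\curvearrowright X)=\sup_{\mathcal P}\inf_F\frac{1}{|F|}H_\mu(\mathcal P^F)$, where $\mathcal P$ ranges over finite Borel partitions of $X$, $F$ ranges over nonempty finite subsets of $\Gamma$,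 $\mathcal P^F=\bigvee_{s\in F}s^{-1}\mathcal P$, and $H_\mu(\mathcal Q)=-\sum_{q\in\mathcal Q}\mu(q)\log\mu(q)$ is the Shannon entropy of a finite Borel partition $\mathcal Q$. *)

theory Defs
  imports "HOL-Probability.Probability" "HOL-Algebra.Group_Action"
begin

section \<open>Continuous and distal actions\<close>

text \<open>The acting group is discrete, so joint continuity of the action amounts to continuity of
  every group element.\<close>

definition continuous_action ::
    "('g, 'm) monoid_scheme \<Rightarrow> 'x topology \<Rightarrow> ('g \<Rightarrow> 'x \<Rightarrow> 'x) \<Rightarrow> bool" where
  "continuous_action G X \<phi> \<longleftrightarrow>
     group_action G (topspace X) \<phi> \<and> (\<forall>s\<in>carrier G. continuous_map X X (\<phi> s))"

definition compatible_metric :: "'x topology \<Rightarrow> ('x \<Rightarrow> 'x \<Rightarrow> real) \<Rightarrow> bool" where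
  "compatible_metric X \<rho> \<longleftrightarrow>
     Metric_space (topspace X) \<rho> \<and> Metric_space.mtopology (topspace X) \<rho> = X"

definition distal_wrt ::
    "('g, 'm) monoid_scheme \<Rightarrow> 'x topology \<Rightarrow> ('g \<Rightarrow> 'x \<Rightarrow> 'x) \<Rightarrow> ('x \<Rightarrow> 'x \<Rightarrow> real) \<Rightarrow> bool" where
  "distal_wrt G X \<phi> \<rho> \<longleftrightarrow>
     (\<forall>x\<in>topspace X. \<forall>y\<in>topspace X. x \<noteq> y \<longrightarrow> (INF s\<in>carrier G. \<rho> (\<phi> s x) (\<phi> s y)) > 0)"

text \<open>On a compact space the choice of the compatible metric is irrelevant; see
  \<open>distal_iff_distal_wrt\<close> below.\<close>

definition distal ::
    "('g, 'm) monoid_scheme \<Rightarrow> 'x topology \<Rightarrow> ('g \<Rightarrow> 'x \<Rightarrow> 'x) \<Rightarrow> bool" where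
  "distal G X \<phi> \<longleftrightarrow> (\<exists>\<rho>. compatible_metric X \<rho> \<and> distal_wrt G X \<phi> \<rho>)"

lemma compatible_metric_continuous:
  assumes "compatible_metric X \<rho>"
  shows "continuous_map (prod_topology X X) euclideanreal (\<lambda>(x, y). \<rho> x y)"
proof -
  interpret Metric_space "topspace X" \<rho>
    using assms by (simp add: compatible_metric_def)
  have X: "mtopology = X" using assms by (simp add: compatible_metric_def)
  have "mtopology_of Self = X" by (simp add: mtopology_of_def X)
  then show ?thesis using continuous_map_metric[of Self] by simp
qed

lemma distal_wrt_change_metric:
  assumes act: "continuous_action G X \<phi>" and "compact_space X"
    and \<rho>: "compatible_metric X \<rho>" and \<sigma>: "compatible_metric X \<sigma>"
    and dist: "distal_wrt G X \<phi> \<rho>"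
  shows "distal_wrt G X \<phi> \<sigma>"
  unfolding distal_wrt_def
proof (intro ballI impI)
  fix x y assume xy: "x \<in> topspace X" "y \<in> topspace X" "x \<noteq> y"
  interpret R: Metric_space "topspace X" \<rho> using \<rho> by (simp add: compatible_metric_def)
  interpret S: Metric_space "topspace X" \<sigma> using \<sigma> by (simp add: compatible_metric_def)
  interpret group_action G "topspace X" \<phi> using act by (simp add: continuous_action_def)
  interpret group_hom G "BijGroup (topspace X)" \<phi> by (rule group_hom)
  have in_X: "\<phi> s z \<in> topspace X" if "s \<in> carrier G" "z \<in> topspace X" for s z
    using element_image that by blast
  define c where "c = (INF s\<in>carrier G. \<rho> (\<phi> s x) (\<phi> s y))"
  have "c > 0" using dist xy by (auto simp: distal_wrt_def c_def)
  have c_le: "c \<le> \<rho> (\<phi> s x) (\<phi> s y)" if "s \<in> carrier G" for s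
    unfolding c_def by (rule cINF_lower) (use that in \<open>auto intro!: bdd_belowI2[of _ 0]\<close>)
  let ?XX = "prod_topology X X"
  define K where "K = {z \<in> topspace ?XX. (case z of (a, b) \<Rightarrow> \<rho> a b) \<in> {c..}}"
  have "closedin ?XX K"
    unfolding K_def using compatible_metric_continuous[OF \<rho>]
    by (rule closedin_continuous_map_preimage) simp
  then have "compactin ?XX K"
    using assms(2) by (simp add: closedin_compact_space compact_space_prod_topology)
  then have "compact ((\<lambda>(a, b). \<sigma> a b) ` K)"
    using image_compactin[OF _ compatible_metric_continuous[OF \<sigma>]] by simp
  moreover have K: "(\<phi> s x, \<phi> s y) \<in> K" if "s \<in> carrier G" for s
    using c_le[OF that] in_X that xy by (simp add: K_def)
  ultimately obtain m where m: "m \<in> (\<lambda>(a, b). \<sigma> a b) ` K"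
      "\<And>t. t \<in> (\<lambda>(a, b). \<sigma> a b) ` K \<Longrightarrow> m \<le> t"
    using compact_attains_inf[of "(\<lambda>(a, b). \<sigma> a b) ` K"] one_closed by blast
  then obtain a b where ab: "(a, b) \<in> K" "m = \<sigma> a b" by auto
  then have "a \<in> topspace X" "b \<in> topspace X" "\<rho> a b \<ge> c" by (auto simp: K_def)
  then have "m > 0"
    using \<open>c > 0\<close> ab(2) R.zero S.mdist_pos_eq by (metis not_le)
  moreover have "m \<le> (INF s\<in>carrier G. \<sigma> (\<phi> s x) (\<phi> s y))"
  proof (rule cINF_greatest)
    show "carrier G \<noteq> {}" using one_closed by blast
    fix s assume "s \<in> carrier G"
    from m(2)[OF imageI[OF K[OF this]]] show "m \<le> \<sigma> (\<phi> s x) (\<phi> s y)" by simp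
  qed
  ultimately show "(INF s\<in>carrier G. \<sigma> (\<phi> s x) (\<phi> s y)) > 0" by simp
qed

lemma distal_iff_distal_wrt:
  assumes "continuous_action G X \<phi>" "compact_space X" "compatible_metric X \<rho>"
  shows "distal G X \<phi> \<longleftrightarrow> distal_wrt G X \<phi> \<rho>"
  using assms distal_wrt_change_metric unfolding distal_def by metis


section \<open>Joins and pullbacks of families of sets\<close>

definition family_join :: "'x set set \<Rightarrow> 'x set set \<Rightarrow> 'x set set" where
  "family_join \<U> \<V> = {U \<inter> V | U V. U \<in> \<U> \<and> V \<in> \<V>}"

text \<open>The join of an indexed family over a nonempty finite index set, obtained by choosing one
  member of each \<open>\<W> s\<close>. The lemmas below identify it with the iterated binary join.\<close>

definition big_family_join :: "'i set \<Rightarrow> ('i \<Rightarrow> 'x set set) \<Rightarrow> 'x set set" where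
  "big_family_join F \<W> = {\<Inter>s\<in>F. f s | f. \<forall>s\<in>F. f s \<in> \<W> s}"

lemma big_family_join_singleton: "big_family_join {s} \<W> = \<W> s"
proof (intro equalityI subsetI)
  fix A assume "A \<in> \<W> s"
  then have "A = (\<Inter>t\<in>{s}. (\<lambda>_. A) t) \<and> (\<forall>t\<in>{s}. (\<lambda>_. A) t \<in> \<W> t)" by simp
  then show "A \<in> big_family_join {s} \<W>"
    unfolding big_family_join_def by blast
qed (auto simp: big_family_join_def)

lemma big_family_join_insert:
  assumes "s \<notin> F"
  shows "big_family_join (insert s F) \<W> = family_join (\<W> s) (big_family_join F \<W>)"
proof (intro equalityI subsetI)
  fix A assume "A \<in> big_family_join (insert s F) \<W>"
  then obtain f where f: "\<forall>t\<in>insert s F. f t \<in> \<W> t" "A = (\<Inter>t\<in>insert s F. f t)"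
    unfolding big_family_join_def by blast
  then have "A = f s \<inter> (\<Inter>t\<in>F. f t)" "f s \<in> \<W> s" "\<forall>t\<in>F. f t \<in> \<W> t" by auto
  then show "A \<in> family_join (\<W> s) (big_family_join F \<W>)"
    unfolding big_family_join_def family_join_def by blast
next
  fix A assume "A \<in> family_join (\<W> s) (big_family_join F \<W>)"
  then obtain U f where Uf: "U \<in> \<W> s" "\<forall>t\<in>F. f t \<in> \<W> t" "A = U \<inter> (\<Inter>t\<in>F. f t)"
    unfolding big_family_join_def family_join_def mem_Collect_eq by metis
  define g where "g = f(s := U)"
  have g: "g t = f t" if "t \<in> F" for t using assms that by (auto simp: g_def)
  have gs: "g s = U" by (simp add: g_def)
  have "A = (\<Inter>t\<in>insert s F. g t)" using Uf(3) g gs by simp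
  moreover have "\<forall>t\<in>insert s F. g t \<in> \<W> t" using Uf g gs by auto
  ultimately show "A \<in> big_family_join (insert s F) \<W>"
    unfolding big_family_join_def by blast
qed

definition pullback :: "'x set \<Rightarrow> ('x \<Rightarrow> 'x) \<Rightarrow> 'x set set \<Rightarrow> 'x set set" where
  "pullback S f \<U> = (\<lambda>U. f -` U \<inter> S) ` \<U>"

text \<open>\<open>\<U>\<^sup>F\<close>, the join of the families \<open>s\<^sup>-\<^sup>1 \<U>\<close> over \<open>s \<in> F\<close>.\<close>

definition dynamical_join ::
    "'x set \<Rightarrow> ('g \<Rightarrow> 'x \<Rightarrow> 'x) \<Rightarrow> 'x set set \<Rightarrow> 'g set \<Rightarrow> 'x set set" where
  "dynamical_join S \<phi> \<U> F = big_family_join F (\<lambda>s. pullback S (\<phi> s) \<U>)"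

definition nonempty_finite_subsets :: "'g set \<Rightarrow> 'g set set" where
  "nonempty_finite_subsets A = {F. F \<subseteq> A \<and> finite F \<and> F \<noteq> {}}"


section \<open>Naive topological entropy\<close>

definition finite_open_covers :: "'x topology \<Rightarrow> 'x set set set" where
  "finite_open_covers X = {\<U>. finite \<U> \<and> (\<forall>U\<in>\<U>. openin X U) \<and> \<Union>\<U> = topspace X}"

text \<open>Only used when \<open>\<U>\<close> is itself a finite cover of \<open>S\<close>.\<close>

definition min_subcover_card :: "'x set \<Rightarrow> 'x set set \<Rightarrow> nat" where
  "min_subcover_card S \<U> = (LEAST n. \<exists>\<V>\<subseteq>\<U>. finite \<V> \<and> \<Union>\<V> = S \<and> card \<V> = n)"

text \<open>Values are extended reals, since the suprema may be infinite.\<close>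

definition naive_top_entropy_cover ::
    "('g, 'm) monoid_scheme \<Rightarrow> 'x topology \<Rightarrow> ('g \<Rightarrow> 'x \<Rightarrow> 'x) \<Rightarrow> 'x set set \<Rightarrow> ereal" where
  "naive_top_entropy_cover G X \<phi> \<U> =
     (INF F\<in>nonempty_finite_subsets (carrier G).
        ereal (ln (real (min_subcover_card (topspace X) (dynamical_join (topspace X) \<phi> \<U> F)))
               / real (card F)))"

definition naive_top_entropy ::
    "('g, 'm) monoid_scheme \<Rightarrow> 'x topology \<Rightarrow> ('g \<Rightarrow> 'x \<Rightarrow> 'x) \<Rightarrow> ereal" where
  "naive_top_entropy G X \<phi> = (SUP \<U>\<in>finite_open_covers X. naive_top_entropy_cover G X \<phi> \<U>)"


section \<open>Naive measure entropy\<close>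

definition borel_prob_measure :: "'x topology \<Rightarrow> 'x measure \<Rightarrow> bool" where
  "borel_prob_measure X \<mu> \<longleftrightarrow>
     prob_space \<mu> \<and> space \<mu> = topspace X \<and> sets \<mu> = sigma_sets (topspace X) {U. openin X U}"

definition invariant_measure ::
    "('g, 'm) monoid_scheme \<Rightarrow> ('g \<Rightarrow> 'x \<Rightarrow> 'x) \<Rightarrow> 'x measure \<Rightarrow> bool" where
  "invariant_measure G \<phi> \<mu> \<longleftrightarrow>
     (\<forall>s\<in>carrier G. \<forall>A\<in>sets \<mu>. emeasure \<mu> (\<phi> s -` A \<inter> space \<mu>) = emeasure \<mu> A)"

definition finite_measurable_partitions :: "'x measure \<Rightarrow> 'x set set set" where
  "finite_measurable_partitions \<mu> = {\<P>. finite \<P> \<and> \<P> \<subseteq> sets \<mu> \<and> partition_on (space \<mu>) \<P>}"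

text \<open>Since \<open>ln 0 = 0\<close>, null members (in particular the empty set, which a join of partitions may
  contain) contribute nothing.\<close>

definition shannon_entropy :: "'x measure \<Rightarrow> 'x set set \<Rightarrow> real" where
  "shannon_entropy \<mu> \<Q> = - (\<Sum>q\<in>\<Q>. measure \<mu> q * ln (measure \<mu> q))"

definition naive_measure_entropy ::
    "('g, 'm) monoid_scheme \<Rightarrow> 'x measure \<Rightarrow> ('g \<Rightarrow> 'x \<Rightarrow> 'x) \<Rightarrow> ereal" where
  "naive_measure_entropy G \<mu> \<phi> =
     (SUP \<P>\<in>finite_measurable_partitions \<mu>.
        INF F\<in>nonempty_finite_subsets (carrier G).
          ereal (shannon_entropy \<mu> (dynamical_join (space \<mu>) \<phi> \<P> F) / real (card F)))"

end

theory Submission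
  imports Defs
begin

text \<open>Choose finite \<open>K\<^sub>1, K\<^sub>2, \<dots> \<subseteq> \<Gamma>\<close> such that all the products in \<open>P\<^sub>n = K\<^sub>1 \<cdots> K\<^sub>n\<close> are distinct, which is
  possible in every infinite group, and use \<open>F = P\<^sub>n\<close> for large \<open>n\<close>. For \<open>i \<le> n\<close> the set
  \<open>S\<^sub>i = K\<^bsub>i+1\<^esub> \<cdots> K\<^sub>n\<close> has density \<open>1 / |P\<^sub>i|\<close> in \<open>F = P\<^sub>i S\<^sub>i\<close>. Let \<open>\<V>\<close> be the join of the covers
  \<open>t\<^sup>-\<^sup>1 \<V>\<^sub>i\<close> with \<open>i \<le> n\<close> and \<open>t \<in> S\<^sub>i\<close>, where the members of \<open>\<V>\<^sub>i\<close> have diameter at most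
  \<open>1 / (i + 1)\<close>. If the \<open>|P\<^sub>i|\<close> grow fast enough then \<open>log |\<V>| \<le> \<epsilon> |F|\<close>. If \<open>x, y\<close> lie in one member of \<open>\<V>\<close>
  and \<open>s = p t \<in> F\<close> with \<open>p \<in> P\<^sub>i\<close> and \<open>t \<in> S\<^sub>i\<close>, then \<open>p\<^sup>-\<^sup>1\<close> brings the pair \<open>(s x, s y)\<close> to distance
  at most \<open>1 / (i + 1)\<close>. By distality and compactness no pair at distance at least \<open>\<delta>\<close> admits such \<open>p\<close> for
  all \<open>i \<le> n\<close>, once \<open>n\<close> is large. Hence every \<open>s \<in> F\<close> maps every member of \<open>\<V>\<close> to a set of diameter
  less than \<open>\<delta>\<close>: up to \<open>exp (\<epsilon> |F|)\<close> choices, orbits along \<open>F\<close> are determined at scale \<open>\<delta>\<close>.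
  For measures, a partition is approximated from inside by closed sets, and the exceptional set of
  small measure contributes little by invariance.\<close>

section \<open>Towers of direct products in infinite groups\<close>

text \<open>A greedy construction: when \<open>K\<close> is enlarged by \<open>a\<close>, two
  products can coincide only if \<open>a = inv p \<otimes> (q \<otimes> k)\<close> for some
  \<open>p\<close>, \<open>q\<close> in \<open>P\<close> and \<open>k\<close> in \<open>K\<close>.
  These are finitely many elements, so an infinite group always offers a further \<open>a\<close>
  outside them and outside \<open>K\<close>.\<close>

lemma (in group) ex_direct_set_mult:
  assumes P: "P \<subseteq> carrier G" "finite P" and inf: "infinite (carrier G)"
  shows "\<exists>K. K \<subseteq> carrier G \<and> finite K \<and> card K = n \<and> card (P <#> K) = card P * n"
proof (induction n)
  case 0
  then show ?case by (intro exI[of _ "{}"]) (auto simp: set_mult_def)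
next
  case (Suc n)
  then obtain K where K: "K \<subseteq> carrier G" "finite K" "card K = n" "card (P <#> K) = card P * n"
    by auto
  define B where "B = K \<union> (\<Union>p\<in>P. \<Union>q\<in>P. \<Union>k\<in>K. {inv p \<otimes> (q \<otimes> k)})"
  have "finite B" using K P by (auto simp: B_def)
  then obtain a where a: "a \<in> carrier G" "a \<notin> B" using inf by (meson finite_subset subsetI)
  have eq: "P <#> insert a K = (\<lambda>p. p \<otimes> a) ` P \<union> (P <#> K)"
    by (auto simp: set_mult_def)
  have "(\<lambda>p. p \<otimes> a) ` P \<inter> (P <#> K) = {}"
  proof (rule ccontr)
    assume "\<not> ?thesis"
    then obtain p q k where pqk: "p \<in> P" "q \<in> P" "k \<in> K" "p \<otimes> a = q \<otimes> k"
      by (auto simp: set_mult_def)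
    moreover from this have "p \<in> carrier G" "q \<in> carrier G" "k \<in> carrier G" using P K by auto
    ultimately have "a = inv p \<otimes> (q \<otimes> k)" using a inv_solve_left by auto
    then show False using a pqk by (auto simp: B_def)
  qed
  moreover have "card ((\<lambda>p. p \<otimes> a) ` P) = card P"
    using P a right_cancel by (intro card_image inj_onI) (auto simp: subset_iff)
  moreover have "finite (P <#> K)" using P K by (auto simp: set_mult_def)
  ultimately have "card (P <#> insert a K) = card P * Suc n"
    using P K eq by (simp add: card_Un_disjoint)
  then show ?case using K a by (intro exI[of _ "insert a K"]) (auto simp: B_def)
qed

lemma card_set_mult_le:
  assumes "finite P" "finite K"
  shows "card (P <#>\<^bsub>G\<^esub> K) \<le> card P * card K"
proof -
  have "P <#>\<^bsub>G\<^esub> K = (\<lambda>(p, k). p \<otimes>\<^bsub>G\<^esub> k) ` (P \<times> K)" by (auto simp: set_mult_def)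
  then show ?thesis using card_image_le[of "P \<times> K"] assms by (simp add: card_cartesian_product)
qed

text \<open>Each stage multiplies the previous one on the right by a fresh \<open>K\<close> with all
  products distinct, so \<open>S\<close> can be taken as the product of the factors used between
  stages \<open>i\<close> and \<open>n\<close>. The cardinality inequality says that
  \<open>S\<close> has density at most \<open>1 / card (P i)\<close> in \<open>P n\<close>. The
  function \<open>N\<close> lets the growth be prescribed in advance.\<close>

lemma (in group) ex_product_tower:
  fixes N :: "nat \<Rightarrow> nat"
  assumes inf: "infinite (carrier G)"
  shows "\<exists>P. (\<forall>n. P n \<subseteq> carrier G \<and> finite (P n) \<and> P n \<noteq> {} \<and> N n \<le> card (P n)) \<and>
     (\<forall>i n. i \<le> n \<longrightarrow> (\<exists>S. S \<subseteq> carrier G \<and> finite S \<and> P n = P i <#> S \<and>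
        card (P i) * card S \<le> card (P n)))"
proof -
  define good where "good n P \<longleftrightarrow> P \<subseteq> carrier G \<and> finite P \<and> P \<noteq> {} \<and> N n \<le> card P" for n P
  define ext where "ext P Q \<longleftrightarrow> (\<exists>K. K \<subseteq> carrier G \<and> finite K \<and> Q = P <#> K \<and> card Q = card P * card K)" for P Q
  have ex: "\<exists>Q. good n Q \<and> ext P Q" if P: "P \<subseteq> carrier G" "finite P" "P \<noteq> {}" for P n
  proof -
    \<comment> \<open>The successor keeps the product nonempty even when
      \<open>N n = 0\<close>.\<close>
    obtain K where K: "K \<subseteq> carrier G" "finite K" "card K = Suc (N n)"
        "card (P <#> K) = card P * Suc (N n)"
      using ex_direct_set_mult[OF P(1,2) inf] by blast
    have "card P > 0" using P by (simp add: card_gt_0_iff)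
    then have "N n \<le> card P * Suc (N n)" "0 < card P * Suc (N n)"
      by (cases "card P"; simp)+
    then have "good n (P <#> K)"
      unfolding good_def using K P(1) set_mult_closed[of P K]
      by (metis card_gt_0_iff)
    then show ?thesis unfolding ext_def using K by metis
  qed
  have "\<exists>P. \<forall>n. good n (P n) \<and> ext (P n) (P (Suc n))"
  proof (rule dependent_nat_choice)
    show "\<exists>P. good 0 P" using ex[of "{\<one>}" 0] by auto
    show "\<exists>Q. good (Suc n) Q \<and> ext P Q" if "good n P" for P n
      using ex that unfolding good_def by blast
  qed
  then obtain P where P: "\<And>n. good n (P n)" "\<And>n. ext (P n) (P (Suc n))" by blast
  have "\<exists>S. S \<subseteq> carrier G \<and> finite S \<and> P n = P i <#> S \<and> card (P i) * card S \<le> card (P n)"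
    if "i \<le> n" for i n
    using that
  proof (induction n rule: dec_induct)
    case base
    have "P i <#> {\<one>} = P i" using P(1)[of i] by (simp add: good_def flip: r_coset_eq_set_mult)
    then show ?case by (intro exI[of _ "{\<one>}"]) auto
  next
    case (step n)
    then obtain S where S: "S \<subseteq> carrier G" "finite S" "P n = P i <#> S"
        "card (P i) * card S \<le> card (P n)" by blast
    obtain K where K: "K \<subseteq> carrier G" "finite K" "P (Suc n) = P n <#> K"
        "card (P (Suc n)) = card (P n) * card K"
      using P(2)[of n] by (auto simp: ext_def)
    have "card (P i) * card (S <#> K) \<le> card (P i) * (card S * card K)"
      using card_set_mult_le S K by (intro mult_left_mono) auto
    also have "\<dots> \<le> card (P n) * card K" using S(4) by (simp flip: mult.assoc)
    finally have "card (P i) * card (S <#> K) \<le> card (P (Suc n))" using K by simp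
    moreover have "P (Suc n) = P i <#> (S <#> K)"
      using K S P(1)[of i] set_mult_assoc by (simp add: good_def)
    moreover have "S <#> K \<subseteq> carrier G" "finite (S <#> K)"
      using S K set_mult_closed by (auto simp: set_mult_def)
    ultimately show ?case by blast
  qed
  then show ?thesis using P(1) unfolding good_def by blast
qed

section \<open>Covers adapted to a distal action\<close>

text \<open>Around each point take a ball whose double lies in a member of the cover. For a finite
  subfamily of these balls that still covers, the least radius works for every point by the triangle
  inequality.\<close>

lemma (in Metric_space) ex_Lebesgue_number:
  assumes "compact_space mtopology" and U: "\<And>U. U \<in> \<U> \<Longrightarrow> openin mtopology U" "M \<subseteq> \<Union>\<U>"
  shows "\<exists>\<delta>>0. \<forall>x\<in>M. \<exists>U\<in>\<U>. mball x \<delta> \<subseteq> U"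
proof -
  have "\<exists>r>0. \<exists>U\<in>\<U>. mball x (2 * r) \<subseteq> U" if x: "x \<in> M" for x
  proof -
    obtain U where "U \<in> \<U>" "x \<in> U" using U x by blast
    then obtain r where "r > 0" "mball x r \<subseteq> U" using U by (metis openin_mtopology)
    then show ?thesis using \<open>U \<in> \<U>\<close> by (intro exI[of _ "r / 2"]) auto
  qed
  then obtain r where r: "\<And>x. x \<in> M \<Longrightarrow> r x > 0" "\<And>x. x \<in> M \<Longrightarrow> \<exists>U\<in>\<U>. mball x (2 * r x) \<subseteq> U"
    by metis
  have "compactin mtopology M" using assms(1) by (simp add: compact_space_def)
  moreover have "\<And>B. B \<in> (\<lambda>x. mball x (r x)) ` M \<Longrightarrow> openin mtopology B" by auto
  moreover have "M \<subseteq> \<Union>((\<lambda>x. mball x (r x)) ` M)" using r(1) by auto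
  ultimately obtain \<F> where "finite \<F>" "\<F> \<subseteq> (\<lambda>x. mball x (r x)) ` M" "M \<subseteq> \<Union>\<F>"
    using compactinD[of mtopology M "(\<lambda>x. mball x (r x)) ` M"] by blast
  then obtain C where C: "finite C" "C \<subseteq> M" "M \<subseteq> (\<Union>x\<in>C. mball x (r x))"
    using finite_subset_image[of \<F> "\<lambda>x. mball x (r x)" M] by blast
  \<comment> \<open>Inserting 1 keeps the minimum meaningful when \<open>C\<close> is empty, which
    happens for the empty space.\<close>
  define \<delta> where "\<delta> = Min (insert 1 (r ` C))"
  have "\<delta> > 0" unfolding \<delta>_def using C r(1) by (subst Min_gr_iff) auto
  have \<delta>: "\<delta> \<le> r c" if "c \<in> C" for c
    unfolding \<delta>_def using C(1) that by (intro Min_le) auto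
  have "\<exists>U\<in>\<U>. mball x \<delta> \<subseteq> U" if x: "x \<in> M" for x
  proof -
    obtain c where c: "c \<in> C" "x \<in> mball c (r c)" using C x by blast
    have "mball x \<delta> \<subseteq> mball c (2 * r c)"
    proof
      fix y assume y: "y \<in> mball x \<delta>"
      have "d c y \<le> d c x + d x y" using c y by (intro triangle) auto
      then show "y \<in> mball c (2 * r c)" using c y \<delta>[of c] by auto
    qed
    then show ?thesis using r(2)[of c] c C by blast
  qed
  then show ?thesis using \<open>\<delta> > 0\<close> by blast
qed

text \<open>These weights split a total budget among the scales \<open>i \<le> n\<close>, uniformly
  in \<open>n\<close>.\<close>

lemma sum_half_powers_le_1: "(\<Sum>i\<le>n. (1 / 2) ^ Suc i :: real) \<le> 1"
proof -
  have "(\<Sum>i\<le>n. (1 / 2) ^ Suc i :: real) = 1 - (1 / 2) ^ Suc n" by (induction n) simp_all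
  then show ?thesis by simp
qed

section \<open>Continuous actions of discrete groups on compact metric spaces\<close>

locale compact_metric_action = group_action G M \<phi> + Metric_space M d
  for G (structure) and M :: "'x set" and d \<phi> +
  assumes compact: "compact_space mtopology"
    and continuous: "s \<in> carrier G \<Longrightarrow> continuous_map mtopology mtopology (\<phi> s)"
begin

lemma group: "group G"
  using group_hom by (simp add: group_hom_def)

lemma mem_M: "s \<in> carrier G \<Longrightarrow> x \<in> M \<Longrightarrow> \<phi> s x \<in> M"
  using element_image by blast

lemma continuous_dist:
  assumes "s \<in> carrier G"
  shows "continuous_map (prod_topology mtopology mtopology) euclideanreal
    (\<lambda>z. d (\<phi> s (fst z)) (\<phi> s (snd z)))"
proof -
  have "continuous_map (prod_topology mtopology mtopology) mtopology (\<lambda>z. \<phi> s (fst z))"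
       "continuous_map (prod_topology mtopology mtopology) mtopology (\<lambda>z. \<phi> s (snd z))"
    using continuous_map_compose[OF continuous_map_fst continuous[OF assms]]
      continuous_map_compose[OF continuous_map_snd continuous[OF assms]] by (simp_all add: o_def)
  then show ?thesis
    using continuous_map_mdist[of "prod_topology mtopology mtopology" Self]
    by (simp add: mtopology_of_def)
qed

text \<open>For distinct \<open>x\<close> and \<open>y\<close> the infimum of the orbit distances is
  positive, so it exceeds \<open>1 / real (Suc i)\<close> for some \<open>i\<close>, and then every
  \<open>p\<close> in \<open>P i\<close> keeps the pair apart at that scale. The sets
  \<open>apart i\<close> are therefore an open cover of the compact set of pairs at distance at
  least \<open>\<delta>\<close>, and finitely many of them suffice. They need not be nested, so the
  index \<open>i \<le> n\<close> depends on the pair.\<close>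

lemma distal_far_pairs:
  assumes dist: "distal_wrt G mtopology \<phi> d" and P: "\<And>n. P n \<subseteq> carrier G" "\<And>n. finite (P n)"
    and "\<delta> > 0"
  shows "\<exists>n. \<forall>x\<in>M. \<forall>y\<in>M. \<delta> \<le> d x y \<longrightarrow>
    (\<exists>i\<le>n. \<forall>p\<in>P i. 1 / real (Suc i) < d (\<phi> (inv p) x) (\<phi> (inv p) y))"
proof -
  interpret group G by (rule group)
  let ?XX = "prod_topology mtopology mtopology"
  define apart where "apart i = {z \<in> topspace ?XX. \<forall>p\<in>P i.
      d (\<phi> (inv p) (fst z)) (\<phi> (inv p) (snd z)) \<in> {1 / real (Suc i)<..}}" for i
  have open_apart: "openin ?XX (apart i)" for i
  proof -
    have "apart i = topspace ?XX \<inter> (\<Inter>p\<in>P i. {z \<in> topspace ?XX.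
      d (\<phi> (inv p) (fst z)) (\<phi> (inv p) (snd z)) \<in> {1 / real (Suc i)<..}})"
      by (auto simp: apart_def)
    moreover have "openin ?XX {z \<in> topspace ?XX.
      d (\<phi> (inv p) (fst z)) (\<phi> (inv p) (snd z)) \<in> {1 / real (Suc i)<..}}" if "p \<in> P i" for p
      using P that by (intro openin_continuous_map_preimage[OF continuous_dist]) auto
    moreover have "openin ?XX (topspace ?XX)" by blast
    \<comment> \<open>Finiteness of \<open>P i\<close> makes the intersection open; for empty
      \<open>P i\<close> it is the whole space.\<close>
    ultimately show ?thesis using P(2)[of i]
      by (cases "P i = {}") (auto simp del: topspace_prod_topology intro!: openin_Int openin_Inter)
  qed
  define D where "D = {z \<in> topspace ?XX. d (fst z) (snd z) \<in> {\<delta>..}}"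
  have "continuous_map ?XX euclideanreal (\<lambda>z. d (fst z) (snd z))"
    using continuous_map_mdist[of ?XX Self fst snd]
    by (simp add: mtopology_of_def continuous_map_fst continuous_map_snd)
  then have "closedin ?XX D" unfolding D_def
    by (rule closedin_continuous_map_preimage) simp
  then have "compactin ?XX D"
    using compact by (simp add: closedin_compact_space compact_space_prod_topology)
  moreover have "D \<subseteq> \<Union>(range apart)"
  proof
    fix z assume z: "z \<in> D"
    obtain x y where xy: "z = (x, y)" by force
    have xy': "x \<in> M" "y \<in> M" "x \<noteq> y" using z xy \<open>\<delta> > 0\<close> by (auto simp: D_def)
    define c where "c = (INF s\<in>carrier G. d (\<phi> s x) (\<phi> s y))"
    have "c > 0" using dist xy' by (auto simp: distal_wrt_def c_def)
    then obtain i where i: "1 / real (Suc i) < c" using nat_approx_posE by blast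
    have "c \<le> d (\<phi> s x) (\<phi> s y)" if "s \<in> carrier G" for s
      unfolding c_def by (rule cINF_lower) (use that in \<open>auto intro!: bdd_belowI2[of _ 0]\<close>)
    then have "1 / real (Suc i) < d (\<phi> (inv p) x) (\<phi> (inv p) y)" if "p \<in> P i" for p
      using i P that by (meson inv_closed less_le_trans subsetD)
    then have "z \<in> apart i" using xy xy'(1,2) by (simp add: apart_def)
    then show "z \<in> \<Union>(range apart)" by blast
  qed
  ultimately obtain \<F> where \<F>: "finite \<F>" "\<F> \<subseteq> range apart" "D \<subseteq> \<Union>\<F>"
    using open_apart compactinD[of ?XX D "range apart"] by (metis rangeE)
  then obtain I where I: "finite I" "\<F> = apart ` I" using finite_subset_image[of \<F> apart UNIV] by blast
  then obtain n where n: "\<And>i. i \<in> I \<Longrightarrow> i \<le> n" by (auto simp: finite_nat_set_iff_bounded_le)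
  show ?thesis
  proof (rule exI[of _ n], intro ballI impI)
    fix x y assume "x \<in> M" "y \<in> M" "\<delta> \<le> d x y"
    then have "(x, y) \<in> D" by (auto simp: D_def)
    then obtain i where "i \<in> I" "(x, y) \<in> apart i" using \<F> I by blast
    then have "\<forall>p\<in>P i. 1 / real (Suc i) < d (\<phi> (inv p) x) (\<phi> (inv p) y)"
      by (simp add: apart_def)
    then show "\<exists>i\<le>n. \<forall>p\<in>P i. 1 / real (Suc i) < d (\<phi> (inv p) x) (\<phi> (inv p) y)"
      using n[OF \<open>i \<in> I\<close>] by blast
  qed
qed

text \<open>A coarse description of the orbit at the few times \<open>t\<close> in
  \<open>S i\<close>, made at every scale \<open>i \<le> n\<close>, controls the orbit at all times
  in \<open>F = P n\<close>. If \<open>\<phi> s x\<close> and \<open>\<phi> s y\<close> were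
  \<open>\<delta>\<close>-far, some scale \<open>i\<close> would keep them apart under all
  \<open>inv p\<close>, although \<open>s = p \<otimes> t\<close> and the images under
  \<open>t\<close> are known to be close.\<close>

lemma ex_uniformly_small_cover:
  assumes dist: "distal_wrt G mtopology \<phi> d" and inf: "infinite (carrier G)"
    and "\<delta> > 0" and "\<epsilon> > 0"
  obtains F \<V> where "F \<in> nonempty_finite_subsets (carrier G)" "finite \<V>" "\<Union>\<V> = M"
    "real (card \<V>) \<le> exp (\<epsilon> * real (card F))"
    "\<And>W s x y. W \<in> \<V> \<Longrightarrow> s \<in> F \<Longrightarrow> x \<in> W \<Longrightarrow> y \<in> W \<Longrightarrow> d (\<phi> s x) (\<phi> s y) < \<delta>"
proof -
  interpret group G by (rule group)
  have "mtotally_bounded M"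
    using compact by (simp add: compact_space_eq_mcomplete_mtotally_bounded)
  then have "\<exists>K. finite K \<and> K \<subseteq> M \<and> M \<subseteq> (\<Union>x\<in>K. mball x (1 / (2 * real (Suc i))))" for i
    unfolding mtotally_bounded_def by (auto simp del: of_nat_Suc)
  then obtain C where C: "\<And>i. finite (C i)" "\<And>i. C i \<subseteq> M"
      "\<And>i. M \<subseteq> (\<Union>x\<in>C i. mball x (1 / (2 * real (Suc i))))"
    by metis
  \<comment> \<open>With \<open>card (P i) \<ge> N i\<close>, the net \<open>C i\<close> has at most
    \<open>\<epsilon> * card (P i) / 2 ^ Suc i\<close> points. At most
    \<open>card (P n) / card (P i)\<close> times are recorded at scale \<open>i\<close>, so this
    scale contributes at most \<open>\<epsilon> * card (P n) / 2 ^ Suc i\<close> to the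
    exponent.\<close>
  define N where "N i = nat \<lceil>real (card (C i)) * 2 ^ Suc i / \<epsilon>\<rceil>" for i
  obtain P where P: "\<And>n. P n \<subseteq> carrier G" "\<And>n. finite (P n)" "\<And>n. P n \<noteq> {}"
      "\<And>n. N n \<le> card (P n)"
    and ex: "\<And>i n. i \<le> n \<Longrightarrow> \<exists>S. S \<subseteq> carrier G \<and> finite S \<and> P n = P i <#> S \<and>
        card (P i) * card S \<le> card (P n)"
    using ex_product_tower[OF inf, of N] by metis
  obtain n where n: "\<And>x y. x \<in> M \<Longrightarrow> y \<in> M \<Longrightarrow> \<delta> \<le> d x y \<Longrightarrow>
      \<exists>i\<le>n. \<forall>p\<in>P i. 1 / real (Suc i) < d (\<phi> (inv p) x) (\<phi> (inv p) y)"
    using distal_far_pairs[of P, OF dist P(1,2) \<open>\<delta> > 0\<close>] by blast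
  have "\<forall>i\<in>{..n}. \<exists>S. S \<subseteq> carrier G \<and> finite S \<and> P n = P i <#> S \<and>
        card (P i) * card S \<le> card (P n)"
    using ex by auto
  then obtain S where S: "\<forall>i\<in>{..n}. S i \<subseteq> carrier G \<and> finite (S i) \<and> P n = P i <#> S i \<and>
        card (P i) * card (S i) \<le> card (P n)"
    unfolding bchoice_iff by blast
  have S: "S i \<subseteq> carrier G" "finite (S i)" "P n = P i <#> S i" "card (P i) * card (S i) \<le> card (P n)"
    if "i \<le> n" for i
    using S that by blast+
  \<comment> \<open>An index is a scale together with a time, since one \<open>t\<close> may have to
    be recorded at several scales. A function in \<open>E\<close> names a net point for each index,
    and \<open>L f\<close> collects the points of \<open>M\<close> described by
    \<open>f\<close>.\<close>
  define J where "J = Sigma {..n} S"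
  define L where "L f = {x \<in> M. \<forall>(i, t)\<in>J. \<phi> t x \<in> mball (f (i, t)) (1 / (2 * real (Suc i)))}" for f
  define E where "E = PiE J (\<lambda>(i, t). C i)"
  have finJ: "finite J" using S by (auto simp: J_def)
  have finE: "finite E" using finJ C by (auto simp: E_def intro!: finite_PiE)
  have "\<Union>(L ` E) = M"
  proof (intro equalityI subsetI)
    fix x assume x: "x \<in> M"
    have "\<forall>z\<in>J. \<exists>c. c \<in> C (fst z) \<and> \<phi> (snd z) x \<in> mball c (1 / (2 * real (Suc (fst z))))"
    proof
      fix z assume "z \<in> J"
      then have "fst z \<le> n" "snd z \<in> S (fst z)" by (auto simp: J_def)
      then have "\<phi> (snd z) x \<in> M" using S(1) mem_M x by blast
      then show "\<exists>c. c \<in> C (fst z) \<and> \<phi> (snd z) x \<in> mball c (1 / (2 * real (Suc (fst z))))"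
        using C(3) by blast
    qed
    then obtain f where f: "\<And>z. z \<in> J \<Longrightarrow> f z \<in> C (fst z)"
        "\<And>z. z \<in> J \<Longrightarrow> \<phi> (snd z) x \<in> mball (f z) (1 / (2 * real (Suc (fst z))))"
      by metis
    have "restrict f J \<in> E" using f(1) by (auto simp: E_def)
    moreover have "x \<in> L (restrict f J)"
      using f(2) x unfolding L_def by (auto simp del: in_mball of_nat_Suc)
    ultimately show "x \<in> \<Union>(L ` E)" by blast
  qed (auto simp: L_def)
  moreover have "real (card (L ` E)) \<le> exp (\<epsilon> * real (card (P n)))"
  proof -
    have "real (card (L ` E)) \<le> real (card E)" using finE by (simp add: card_image_le)
    also have "\<dots> = (\<Prod>z\<in>J. real (card (C (fst z))))"
      unfolding E_def using finJ by (simp add: card_PiE case_prod_unfold)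
    also have "\<dots> = (\<Prod>i\<le>n. \<Prod>t\<in>S i. real (card (C i)))"
      unfolding J_def using S(2) by (subst prod.Sigma) (auto simp: case_prod_unfold)
    \<comment> \<open>The crude bound \<open>m \<le> exp m\<close> replaces logarithms of the net
      sizes; \<open>N\<close> was chosen large enough to absorb the loss.\<close>
    also have "\<dots> \<le> (\<Prod>i\<le>n. \<Prod>t\<in>S i. exp (real (card (C i))))"
      by (intro prod_mono conjI prod_nonneg) (auto intro: less_imp_le[OF less_le_trans[OF _ exp_ge_add_one_self]])
    also have "\<dots> = (\<Prod>i\<le>n. exp (real (card (S i)) * real (card (C i))))"
      by (simp add: exp_of_nat_mult)
    also have "\<dots> = exp (\<Sum>i\<le>n. real (card (S i)) * real (card (C i)))"
      by (simp add: exp_sum)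
    also have "\<dots> \<le> exp (\<Sum>i\<le>n. \<epsilon> * real (card (P n)) * (1 / 2) ^ Suc i)"
    proof (subst exp_le_cancel_iff, rule sum_mono)
      fix i assume i: "i \<in> {..n}"
      have "real (card (C i)) * 2 ^ Suc i / \<epsilon> \<le> real (N i)"
        unfolding N_def by linarith
      also have "\<dots> \<le> real (card (P i))" using P(4) by simp
      finally have "real (card (C i)) \<le> \<epsilon> * real (card (P i)) * (1 / 2) ^ Suc i"
        using \<open>\<epsilon> > 0\<close> by (simp add: field_simps)
      then have "real (card (S i)) * real (card (C i))
          \<le> real (card (S i)) * (\<epsilon> * real (card (P i)) * (1 / 2) ^ Suc i)"
        by (intro mult_left_mono) auto
      also have "\<dots> = \<epsilon> * real (card (P i) * card (S i)) * (1 / 2) ^ Suc i" by simp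
      also have "\<dots> \<le> \<epsilon> * real (card (P n)) * (1 / 2) ^ Suc i"
        using S(4)[of i] i \<open>\<epsilon> > 0\<close>
        by (intro mult_right_mono mult_left_mono of_nat_mono) auto
      finally show "real (card (S i)) * real (card (C i)) \<le> \<epsilon> * real (card (P n)) * (1 / 2) ^ Suc i" .
    qed
    also have "\<dots> \<le> exp (\<epsilon> * real (card (P n)))"
    proof -
      have "\<epsilon> * real (card (P n)) * (\<Sum>i\<le>n. (1 / 2) ^ Suc i) \<le> \<epsilon> * real (card (P n)) * 1"
        using \<open>\<epsilon> > 0\<close> by (intro mult_left_mono sum_half_powers_le_1) auto
      then show ?thesis by (simp add: sum_distrib_left)
    qed
    finally show ?thesis .
  qed
  moreover have "d (\<phi> s x) (\<phi> s y) < \<delta>" if "W \<in> L ` E" "s \<in> P n" "x \<in> W" "y \<in> W" for W s x y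
  proof (rule ccontr)
    assume far: "\<not> ?thesis"
    obtain f where f: "W = L f" using \<open>W \<in> L ` E\<close> by blast
    have xy: "x \<in> M" "y \<in> M" using that f by (auto simp: L_def)
    have s: "s \<in> carrier G" using that P by blast
    \<comment> \<open>The scale is dictated by the pair of images under \<open>s\<close>; only
      afterwards is \<open>s\<close> factored at this scale. As all \<open>p\<close> in
      \<open>P i\<close> separate the pair, any factorization serves.\<close>
    obtain i where i: "i \<le> n" "\<And>p. p \<in> P i \<Longrightarrow>
        1 / real (Suc i) < d (\<phi> (inv p) (\<phi> s x)) (\<phi> (inv p) (\<phi> s y))"
      using n[of "\<phi> s x" "\<phi> s y"] far mem_M xy s by auto
    obtain p t where pt: "p \<in> P i" "t \<in> S i" "s = p \<otimes> t"
      using S(3)[OF i(1)] \<open>s \<in> P n\<close> by (auto simp: set_mult_def)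
    have G: "p \<in> carrier G" "t \<in> carrier G" using pt P S(1)[OF i(1)] by blast+
    then have "inv p \<otimes> s = t" using pt by (simp flip: m_assoc)
    then have far': "1 / real (Suc i) < d (\<phi> t x) (\<phi> t y)"
      using i(2)[OF pt(1)] composition_rule[of _ "inv p" s] xy s G by simp
    have "\<phi> t x \<in> mball (f (i, t)) (1 / (2 * real (Suc i)))"
        "\<phi> t y \<in> mball (f (i, t)) (1 / (2 * real (Suc i)))"
      using \<open>x \<in> W\<close> \<open>y \<in> W\<close> f pt i(1) by (auto simp: L_def J_def simp del: in_mball)
    then have "d (\<phi> t x) (\<phi> t y) \<le> d (f (i, t)) (\<phi> t x) + d (f (i, t)) (\<phi> t y)"
        "d (f (i, t)) (\<phi> t x) < 1 / (2 * real (Suc i))" "d (f (i, t)) (\<phi> t y) < 1 / (2 * real (Suc i))"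
      using triangle''[of "\<phi> t x" "f (i, t)" "\<phi> t y"] by (auto simp: commute simp del: of_nat_Suc)
    then have "d (\<phi> t x) (\<phi> t y) < 1 / (2 * real (Suc i)) + 1 / (2 * real (Suc i))"
      by (meson add_strict_mono le_less_trans)
    also have "\<dots> = 1 / real (Suc i)" by (simp add: field_simps)
    finally show False using far' by (rule less_asym)
  qed
  moreover have "P n \<in> nonempty_finite_subsets (carrier G)"
    using P by (simp add: nonempty_finite_subsets_def)
  moreover have "finite (L ` E)" using finE by simp
  ultimately show ?thesis using that by metis
qed

text \<open>Taking \<open>\<delta>\<close> as a Lebesgue number of \<open>\<U>\<close>, each image
  of a member of \<open>\<V>\<close> lies in one ball of radius \<open>\<delta>\<close> and hence in
  one member of \<open>\<U>\<close>. Both entropy estimates start from this form: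
  \<open>u W s\<close> predicts where the points of \<open>W\<close> are at time
  \<open>s\<close>.\<close>

lemma ex_small_refinement:
  assumes dist: "distal_wrt G mtopology \<phi> d" and inf: "infinite (carrier G)"
    and \<U>: "\<U> \<in> finite_open_covers mtopology" and "\<epsilon> > 0"
  obtains F \<V> u where "F \<in> nonempty_finite_subsets (carrier G)" "finite \<V>" "\<Union>\<V> = M"
    "real (card \<V>) \<le> exp (\<epsilon> * real (card F))"
    "\<And>W s. W \<in> \<V> \<Longrightarrow> s \<in> F \<Longrightarrow> u W s \<in> \<U>" "\<And>W s. W \<in> \<V> \<Longrightarrow> s \<in> F \<Longrightarrow> \<phi> s ` W \<subseteq> u W s"
proof -
  have U: "\<And>U. U \<in> \<U> \<Longrightarrow> openin mtopology U" "M \<subseteq> \<Union>\<U>"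
    using \<U> by (simp_all add: finite_open_covers_def)
  obtain \<delta> where \<delta>: "\<delta> > 0" "\<And>x. x \<in> M \<Longrightarrow> \<exists>U\<in>\<U>. mball x \<delta> \<subseteq> U"
    using ex_Lebesgue_number[OF compact U] by blast
  obtain F \<V> where F: "F \<in> nonempty_finite_subsets (carrier G)" and V: "finite \<V>" "\<Union>\<V> = M"
      "real (card \<V>) \<le> exp (\<epsilon> * real (card F))"
    and small: "\<And>W s x y. W \<in> \<V> \<Longrightarrow> s \<in> F \<Longrightarrow> x \<in> W \<Longrightarrow> y \<in> W \<Longrightarrow> d (\<phi> s x) (\<phi> s y) < \<delta>"
    by (rule ex_uniformly_small_cover[OF dist inf \<delta>(1) \<open>\<epsilon> > 0\<close>]) (rule that; assumption)
  \<comment> \<open>An empty \<open>W\<close> supplies no centre for a ball, and over the empty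
    space \<open>\<U>\<close> may have no member to choose. Discarding it preserves the union and
    the cardinality bound.\<close>
  have ex: "\<exists>U. U \<in> \<U> \<and> \<phi> s ` W \<subseteq> U" if W: "W \<in> \<V> - {{}}" "s \<in> F" for W s
  proof -
    obtain x where x: "x \<in> W" using W by blast
    have in_M: "\<phi> s y \<in> M" if "y \<in> W" for y
      using that W V(2) F mem_M by (auto simp: nonempty_finite_subsets_def)
    obtain U where "U \<in> \<U>" "mball (\<phi> s x) \<delta> \<subseteq> U" using \<delta>(2)[OF in_M[OF x]] by blast
    moreover have "\<phi> s ` W \<subseteq> mball (\<phi> s x) \<delta>" using small W x in_M by auto
    ultimately show ?thesis by blast
  qed
  define u where "u W s = (SOME U. U \<in> \<U> \<and> \<phi> s ` W \<subseteq> U)" for W s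
  have u: "u W s \<in> \<U> \<and> \<phi> s ` W \<subseteq> u W s" if "W \<in> \<V> - {{}}" "s \<in> F" for W s
    unfolding u_def using someI_ex[OF ex[OF that]] .
  have "real (card (\<V> - {{}})) \<le> exp (\<epsilon> * real (card F))"
    by (rule order_trans[OF _ V(3)]) (simp add: card_Diff1_le)
  moreover have "\<Union>(\<V> - {{}}) = M" using V(2) by auto
  moreover have "finite (\<V> - {{}})" using V(1) by simp
  ultimately show ?thesis using that[of F "\<V> - {{}}" u] u F by simp
qed

section \<open>Vanishing of the naive topological entropy\<close>

text \<open>For each \<open>W\<close> in \<open>\<V>\<close>, the predictions \<open>u W s\<close>
  over all \<open>s\<close> in \<open>F\<close> single out a member \<open>T W\<close> of the
  dynamical join that contains \<open>W\<close>. These members form a subcover no larger than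
  \<open>\<V>\<close>.\<close>

lemma naive_top_entropy_cover_le:
  assumes dist: "distal_wrt G mtopology \<phi> d" and inf: "infinite (carrier G)"
    and U: "\<U> \<in> finite_open_covers mtopology" and "\<epsilon> > 0"
  shows "naive_top_entropy_cover G mtopology \<phi> \<U> \<le> ereal \<epsilon>"
proof -
  obtain F \<V> u where F: "F \<in> nonempty_finite_subsets (carrier G)" and V: "finite \<V>" "\<Union>\<V> = M"
      "real (card \<V>) \<le> exp (\<epsilon> * real (card F))"
    and u: "\<And>W s. W \<in> \<V> \<Longrightarrow> s \<in> F \<Longrightarrow> u W s \<in> \<U>" "\<And>W s. W \<in> \<V> \<Longrightarrow> s \<in> F \<Longrightarrow> \<phi> s ` W \<subseteq> u W s"
    by (rule ex_small_refinement[OF dist inf U \<open>\<epsilon> > 0\<close>]) (rule that; assumption)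
  define T where "T W = (\<Inter>s\<in>F. \<phi> s -` u W s \<inter> M)" for W
  let ?N = "min_subcover_card M (dynamical_join M \<phi> \<U> F)"
  have card_F: "card F > 0" using F by (auto simp: nonempty_finite_subsets_def card_gt_0_iff)
  have sub: "T ` \<V> \<subseteq> dynamical_join M \<phi> \<U> F"
  proof (rule image_subsetI)
    fix W assume "W \<in> \<V>"
    then have "\<forall>s\<in>F. \<phi> s -` u W s \<inter> M \<in> pullback M (\<phi> s) \<U>"
      using u(1) unfolding pullback_def by blast
    then show "T W \<in> dynamical_join M \<phi> \<U> F"
      unfolding dynamical_join_def big_family_join_def T_def by blast
  qed
  have "W \<subseteq> T W" if W: "W \<in> \<V>" for W
    using u(2)[OF W] W V(2) unfolding T_def by blast
  moreover have "T W \<subseteq> M" for W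
    using F by (auto simp: T_def nonempty_finite_subsets_def)
  ultimately have "\<Union>(T ` \<V>) = M" using V(2) by blast
  then have "?N \<le> card (T ` \<V>)"
    unfolding min_subcover_card_def using sub V(1)
    by (intro Least_le exI[of _ "T ` \<V>"]) simp
  also have "\<dots> \<le> card \<V>" by (rule card_image_le[OF V(1)])
  finally have N: "real ?N \<le> exp (\<epsilon> * real (card F))" using V(3) by simp
  have "ln (real ?N) \<le> \<epsilon> * real (card F)"
  \<comment> \<open>The value 0 occurs only for the empty space, where the convention
    \<open>ln 0 = 0\<close> applies.\<close>
  proof (cases "?N = 0")
    case False
    then show ?thesis using N ln_le_cancel_iff[of "real ?N" "exp (\<epsilon> * real (card F))"] by simp
  qed (use \<open>\<epsilon> > 0\<close> in simp)
  then have "ln (real ?N) / real (card F) \<le> \<epsilon>" using card_F by (simp add: divide_le_eq)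
  then show ?thesis
    unfolding naive_top_entropy_cover_def by - (rule INF_lower2[OF F], simp)
qed

lemma naive_top_entropy_eq_0:
  assumes "distal_wrt G mtopology \<phi> d" and "infinite (carrier G)"
  shows "naive_top_entropy G mtopology \<phi> = 0"
proof (rule antisym)
  show "naive_top_entropy G mtopology \<phi> \<le> 0"
    unfolding naive_top_entropy_def
  proof (rule SUP_least)
    fix \<U> assume "\<U> \<in> finite_open_covers mtopology"
    then have "naive_top_entropy_cover G mtopology \<phi> \<U> \<le> 0 + ereal \<epsilon>" if "\<epsilon> > 0" for \<epsilon>
      using naive_top_entropy_cover_le[OF assms _ that] by simp
    then show "naive_top_entropy_cover G mtopology \<phi> \<U> \<le> 0"
      by (rule ereal_le_epsilon2)
  qed
  \<comment> \<open>A supremum over no covers would be \<open>-\<infinity>\<close>, so the lower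
    bound needs one cover; the trivial one suffices because every term is nonnegative.\<close>
  have "{M} \<in> finite_open_covers mtopology"
    using openin_topspace[of mtopology] by (simp add: finite_open_covers_def)
  moreover have "0 \<le> naive_top_entropy_cover G mtopology \<phi> {M}"
    unfolding naive_top_entropy_cover_def
  proof (rule INF_greatest)
    fix F :: "'a set"
    have "0 \<le> ln (real k) / real (card F)" for k :: nat by (cases "k = 0") simp_all
    then show "0 \<le> ereal (ln (real (min_subcover_card (topspace mtopology)
      (dynamical_join (topspace mtopology) \<phi> {M} F))) / real (card F))"
      by (simp only: zero_ereal_def ereal_less_eq)
  qed
  ultimately show "0 \<le> naive_top_entropy G mtopology \<phi>"
    unfolding naive_top_entropy_def by (rule SUP_upper2)
qed

end

section \<open>Measure entropy\<close>

text \<open>Bounding \<open>U - C\<close>, with approximation from both sides at once, makes the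
  property invariant under complements. The induction over the generated sigma-algebra then has
  substance only for open sets and countable unions.\<close>

lemma ex_closed_open_approximation:
  assumes X: "metrizable_space X" and fin: "finite_measure \<mu>" and sp: "space \<mu> = topspace X"
    and sets: "sets \<mu> = sigma_sets (topspace X) {U. openin X U}"
    and A: "A \<in> sets \<mu>" and "\<epsilon> > 0"
  shows "\<exists>C U. closedin X C \<and> openin X U \<and> C \<subseteq> A \<and> A \<subseteq> U \<and> measure \<mu> (U - C) < \<epsilon>"
proof -
  interpret finite_measure \<mu> by (rule fin)
  have op: "U \<in> sets \<mu>" if "openin X U" for U using that sets by auto
  have cl: "C \<in> sets \<mu>" if "closedin X C" for C
  proof -
    have "topspace X - C \<in> sets \<mu>" using that by (intro op) (simp add: openin_diff)
    then have "space \<mu> - (topspace X - C) \<in> sets \<mu>" by (rule sets.compl_sets)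
    then show ?thesis using closedin_subset[OF that] sp by (simp add: double_diff)
  qed
  have "A \<in> sigma_sets (topspace X) {U. openin X U}" using A sets by simp
  then show ?thesis using \<open>\<epsilon> > 0\<close>
  proof (induction arbitrary: \<epsilon> rule: sigma_sets.induct)
    case (Basic A \<epsilon>)
    then have A: "openin X A" by simp
    have \<epsilon>: "0 < \<epsilon>" by (rule Basic.prems)
    \<comment> \<open>In a metrizable space an open set is an increasing union of closed sets, and
      continuity from below makes one of them nearly full.\<close>
    obtain C where C: "\<And>n. closedin X (C n)" "\<And>n. C n \<subseteq> C (Suc n)" "\<Union>(range C) = A"
      using open_imp_fsigma_in[OF X A] unfolding fsigma_in_ascending by (elim exE conjE) (rule that; simp)
    have "range C \<subseteq> sets \<mu>" using cl[OF C(1)] by blast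
    then have "(\<lambda>n. measure \<mu> (C n)) \<longlonglongrightarrow> measure \<mu> A"
      using finite_Lim_measure_incseq[OF _ incseq_SucI[of C, OF C(2)]] C(3) by simp
    moreover have "measure \<mu> A - \<epsilon> < measure \<mu> A" using \<epsilon> by simp
    ultimately have "\<forall>\<^sub>F n in sequentially. measure \<mu> A - \<epsilon> < measure \<mu> (C n)"
      by (rule order_tendstoD(1))
    then obtain n where n: "measure \<mu> A - \<epsilon> < measure \<mu> (C n)"
      unfolding eventually_sequentially by blast
    have "C n \<subseteq> A" using C(3) by blast
    then have "measure \<mu> (A - C n) < \<epsilon>"
      using n finite_measure_Diff[OF op[OF A] cl[OF C(1)[of n]]] by linarith
    then have "closedin X (C n) \<and> openin X A \<and> C n \<subseteq> A \<and> A \<subseteq> A \<and> measure \<mu> (A - C n) < \<epsilon>"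
      using A C(1) \<open>C n \<subseteq> A\<close> by simp
    then show ?case by (intro exI)
  next
    case (Empty \<epsilon>)
    then have "closedin X {} \<and> openin X {} \<and> {} \<subseteq> ({} :: 'a set) \<and> ({} :: 'a set) \<subseteq> {} \<and>
        measure \<mu> ({} - {}) < \<epsilon>" by simp
    then show ?case by (intro exI)
  next
    case (Compl A \<epsilon>)
    obtain C U where CU: "closedin X C" "openin X U" "C \<subseteq> A" "A \<subseteq> U" "measure \<mu> (U - C) < \<epsilon>"
      using Compl.IH[OF Compl.prems] by blast
    have "(topspace X - C) - (topspace X - U) = U - C"
      using openin_subset[OF CU(2)] by blast
    then have "closedin X (topspace X - U) \<and> openin X (topspace X - C) \<and>
        topspace X - U \<subseteq> topspace X - A \<and> topspace X - A \<subseteq> topspace X - C \<and>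
        measure \<mu> ((topspace X - C) - (topspace X - U)) < \<epsilon>"
      using CU by (auto intro: closedin_diff openin_diff)
    then show ?case by (intro exI)
  next
    case (Union A \<epsilon>)
    \<comment> \<open>The errors at the individual sets add up to \<open>\<epsilon> / 2\<close>. The
      other half pays for replacing the union of all \<open>C i\<close>, which need not be closed,
      by a finite union \<open>D n\<close>.\<close>
    have pos: "0 < \<epsilon> / 2 * (1 / 2) ^ Suc i" for i :: nat using Union.prems by simp
    have "\<forall>i. \<exists>C U. closedin X C \<and> openin X U \<and> C \<subseteq> A i \<and> A i \<subseteq> U \<and>
        measure \<mu> (U - C) < \<epsilon> / 2 * (1 / 2) ^ Suc i"
      using Union.IH[OF pos] by (intro allI)
    then have "\<exists>C U. \<forall>i. closedin X (C i) \<and> openin X (U i) \<and> C i \<subseteq> A i \<and> A i \<subseteq> U i \<and>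
        measure \<mu> (U i - C i) < \<epsilon> / 2 * (1 / 2) ^ Suc i"
      unfolding choice_iff .
    then obtain C U where CU: "\<And>i. closedin X (C i)" "\<And>i. openin X (U i)" "\<And>i. C i \<subseteq> A i"
        "\<And>i. A i \<subseteq> U i" "\<And>i. measure \<mu> (U i - C i) < \<epsilon> / 2 * (1 / 2) ^ Suc i"
      by blast
    define D where "D n = (\<Union>i\<le>n. C i)" for n
    have D: "closedin X (D n)" for n unfolding D_def using CU(1) by (intro closedin_Union) auto
    have UD: "(\<Union>n. D n) = (\<Union>i. C i)" unfolding D_def by blast
    have "range D \<subseteq> sets \<mu>" using cl[OF D] by blast
    moreover have "D n \<subseteq> D (Suc n)" for n unfolding D_def by (intro UN_mono) auto
    ultimately have "(\<lambda>n. measure \<mu> (D n)) \<longlonglongrightarrow> measure \<mu> (\<Union>i. C i)"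
      using finite_Lim_measure_incseq[OF _ incseq_SucI[of D]] UD by simp
    moreover have "measure \<mu> (\<Union>i. C i) - \<epsilon> / 2 < measure \<mu> (\<Union>i. C i)" using Union.prems by simp
    ultimately have "\<forall>\<^sub>F n in sequentially. measure \<mu> (\<Union>i. C i) - \<epsilon> / 2 < measure \<mu> (D n)"
      by (rule order_tendstoD(1))
    then obtain n where n: "measure \<mu> (\<Union>i. C i) - \<epsilon> / 2 < measure \<mu> (D n)"
      unfolding eventually_sequentially by blast
    have mC: "(\<Union>i. C i) \<in> sets \<mu>" and mU: "U i - C i \<in> sets \<mu>" for i
      using cl[OF CU(1)] op[OF CU(2)] by blast+
    have "D n \<subseteq> (\<Union>i. C i)" unfolding D_def by blast
    then have 1: "measure \<mu> ((\<Union>i. C i) - D n) < \<epsilon> / 2"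
      using n finite_measure_Diff[OF mC cl[OF D[of n]]] by linarith
    have sums: "(\<lambda>i. \<epsilon> / 2 * (1 / 2) ^ Suc i) sums (\<epsilon> / 2 * 1)"
      by (intro sums_mult power_half_series)
    have summ: "summable (\<lambda>i. measure \<mu> (U i - C i))"
      by (rule summable_comparison_test'[OF sums_summable[OF sums], of 0])
         (use CU(5) in \<open>simp add: less_imp_le\<close>)
    have "measure \<mu> (\<Union>i. U i - C i) \<le> (\<Sum>i. measure \<mu> (U i - C i))"
      using mU summ by (intro finite_measure_subadditive_countably) auto
    also have "\<dots> \<le> \<epsilon> / 2"
      using suminf_le[OF less_imp_le[OF CU(5)] summ sums_summable[OF sums]] sums_unique[OF sums]
      by simp
    finally have 2: "measure \<mu> (\<Union>i. U i - C i) \<le> \<epsilon> / 2" .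
    have mUU: "(\<Union>i. U i - C i) \<in> sets \<mu>" using mU by blast
    have "(\<Union>i. U i) - D n \<subseteq> (\<Union>i. U i - C i) \<union> ((\<Union>i. C i) - D n)" by blast
    then have "measure \<mu> ((\<Union>i. U i) - D n) \<le> measure \<mu> ((\<Union>i. U i - C i) \<union> ((\<Union>i. C i) - D n))"
      using mUU mC cl[OF D[of n]] by (intro finite_measure_mono) auto
    also have "\<dots> \<le> measure \<mu> (\<Union>i. U i - C i) + measure \<mu> ((\<Union>i. C i) - D n)"
      using mUU mC cl[OF D[of n]] by (intro measure_Un_le) auto
    finally have "measure \<mu> ((\<Union>i. U i) - D n) < \<epsilon>" using 1 2 by linarith
    moreover have "D n \<subseteq> \<Union>(range A)" unfolding D_def using CU(3) by blast
    moreover have "\<Union>(range A) \<subseteq> (\<Union>i. U i)" using CU(4) by blast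
    moreover have "openin X (\<Union>i. U i)" using CU(2) by blast
    ultimately have "closedin X (D n) \<and> openin X (\<Union>i. U i) \<and> D n \<subseteq> \<Union>(range A) \<and>
        \<Union>(range A) \<subseteq> (\<Union>i. U i) \<and> measure \<mu> ((\<Union>i. U i) - D n) < \<epsilon>"
      using D by simp
    then show ?case by (intro exI)
  qed
qed

section \<open>Bounding Shannon entropy by expected code length\<close>

text \<open>Apply \<open>ln t \<le> t - 1\<close> to \<open>t = w q / m q\<close>, multiply by
  \<open>m q\<close> and sum; a term with \<open>m q = 0\<close> reduces to
  \<open>0 \<le> w q\<close>. An inequality between the total weights is the right hypothesis, since
  later \<open>w\<close> is only a part of a probability distribution.\<close>

lemma Gibbs_inequality:
  fixes m w :: "'a \<Rightarrow> real"
  assumes m: "\<And>q. q \<in> Q \<Longrightarrow> 0 \<le> m q" and w: "\<And>q. q \<in> Q \<Longrightarrow> 0 < w q"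
    and le: "sum w Q \<le> sum m Q"
  shows "- (\<Sum>q\<in>Q. m q * ln (m q)) \<le> (\<Sum>q\<in>Q. m q * - ln (w q))"
proof -
  have "m q * ln (w q) - m q * ln (m q) \<le> w q - m q" if q: "q \<in> Q" for q
  proof (cases "m q = 0")
    case False
    then have pos: "m q > 0" "w q > 0" using m[OF q] w[OF q] by auto
    have "m q * ln (w q / m q) \<le> m q * (w q / m q - 1)"
      using pos by (intro mult_left_mono ln_le_minus_one) auto
    also have "\<dots> = w q - m q" using pos by (simp add: field_simps)
    finally show ?thesis using pos by (simp add: ln_div algebra_simps)
  qed (use w[OF q] in simp)
  then have "(\<Sum>q\<in>Q. m q * ln (w q) - m q * ln (m q)) \<le> (\<Sum>q\<in>Q. w q - m q)"
    by (rule sum_mono)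
  then show ?thesis using le by (simp add: sum_subtractf sum_negf)
qed

text \<open>The entropy is compared, via Gibbs' inequality, with the code that first names a member \<open>W\<close>
  of \<open>\<V>\<close> and then, for each \<open>s\<close>, the member of \<open>\<P>\<close> containing \<open>s x\<close>, giving weight about
  \<open>1 - \<eta>\<close> to the prediction \<open>u W s\<close>.\<close>

lemma shannon_entropy_dynamical_join_le:
  assumes "prob_space \<mu>" and P: "\<P> \<in> finite_measurable_partitions \<mu>"
    and F: "finite F" and V: "finite \<V>" "\<Union>\<V> = space \<mu>" and \<eta>: "0 < \<eta>" "\<eta> < 1"
    and meas: "\<And>s. s \<in> F \<Longrightarrow> \<phi> s \<in> measurable \<mu> \<mu>"
    and u: "\<And>W s. W \<in> \<V> \<Longrightarrow> s \<in> F \<Longrightarrow> u W s \<in> \<P>"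
    and B: "B \<in> sets \<mu>" "\<And>s. s \<in> F \<Longrightarrow> measure \<mu> (\<phi> s -` B \<inter> space \<mu>) = measure \<mu> B"
    and good: "\<And>W s x. W \<in> \<V> \<Longrightarrow> s \<in> F \<Longrightarrow> x \<in> W \<Longrightarrow> \<phi> s x \<notin> B \<Longrightarrow> \<phi> s x \<in> u W s"
    and F_ne: "F \<noteq> {}"
  shows "shannon_entropy \<mu> (dynamical_join (space \<mu>) \<phi> \<P> F) \<le>
    ln (real (card \<V>)) + real (card F) * (- ln (1 - \<eta>) + ln (real (card \<P>) / \<eta>) * measure \<mu> B)"
proof -
  interpret prob_space \<mu> by fact
  have part: "partition_on (space \<mu>) \<P>" and P: "finite \<P>" "\<And>A. A \<in> \<P> \<Longrightarrow> A \<in> sets \<mu>"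
    using P unfolding finite_measurable_partitions_def by blast+
  have P_cover: "\<Union>\<P> = space \<mu>" using partition_onD1[OF part] by simp
  have P_unique: "A = A'" if "A \<in> \<P>" "A' \<in> \<P>" "y \<in> A" "y \<in> A'" for A A' y
    using disjointD[OF partition_onD2[OF part]] that by blast
  define k where "k = real (card \<P>)"
  have "\<P> \<noteq> {}" using P_cover not_empty by auto
  then have k: "k \<ge> 1" using P(1) by (simp add: k_def Suc_le_eq card_gt_0_iff)
  have "\<V> \<noteq> {}" using V(2) not_empty by auto
  then have cV: "card \<V> > 0" using V(1) by (simp add: card_gt_0_iff)
  define L where "L = ln (k / \<eta>)"
  have L: "L \<ge> 0" using k \<eta> by (simp add: L_def)
  \<comment> \<open>The mass \<open>\<eta>\<close> is spread evenly over all of \<open>\<P>\<close>,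
    the predicted member included. This gives every member weight at least
    \<open>\<eta> / k\<close>, so a wrong prediction costs at most \<open>L\<close>.\<close>
  define r where "r W s A = (if A = u W s then 1 - \<eta> else 0) + \<eta> / k" for W s A
  have r_pos: "r W s A > 0" for W s A using \<eta> k by (simp add: r_def add_nonneg_pos)
  have r_sum: "(\<Sum>A\<in>\<P>. r W s A) = 1" if "W \<in> \<V>" "s \<in> F" for W s
    using u[OF that] P(1) k by (simp add: r_def sum.distrib k_def[symmetric])
  \<comment> \<open>The uniform mixture over \<open>W\<close> of product distributions on names
    \<open>f\<close>. Keeping a single summand loses at most \<open>ln (card \<V>)\<close> in code
    length.\<close>
  define w where "w f = (\<Sum>W\<in>\<V>. \<Prod>s\<in>F. r W s (f s)) / real (card \<V>)" for f
  have w_ge: "w f \<ge> (\<Prod>s\<in>F. r W s (f s)) / real (card \<V>)" if "W \<in> \<V>" for W f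
    unfolding w_def using V(1) that r_pos
    by (intro divide_right_mono member_le_sum prod_nonneg) (auto intro: less_imp_le)
  have w_pos: "w f > 0" for f
    unfolding w_def using V(1) \<open>\<V> \<noteq> {}\<close> cV r_pos by (intro divide_pos_pos sum_pos prod_pos) auto
  define E where "E = PiE F (\<lambda>_. \<P>)"
  have finE: "finite E" unfolding E_def using F P(1) by (intro finite_PiE) auto
  have w_sum: "(\<Sum>f\<in>E. w f) = 1"
  proof -
    have "(\<Sum>f\<in>E. w f) = (\<Sum>W\<in>\<V>. \<Sum>f\<in>E. \<Prod>s\<in>F. r W s (f s)) / real (card \<V>)"
      unfolding w_def by (subst sum.swap) (simp add: sum_divide_distrib)
    also have "(\<Sum>W\<in>\<V>. \<Sum>f\<in>E. \<Prod>s\<in>F. r W s (f s)) = (\<Sum>W\<in>\<V>. \<Prod>s\<in>F. \<Sum>A\<in>\<P>. r W s A)"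
      unfolding E_def using F P(1) by (simp add: prod_sum_PiE)
    also have "\<dots> = real (card \<V>)" using r_sum by simp
    finally show ?thesis using cV by simp
  qed
  define T where "T f = (\<Inter>s\<in>F. \<phi> s -` f s \<inter> space \<mu>)" for f
  define Q where "Q = dynamical_join (space \<mu>) \<phi> \<P> F"
  have Q: "\<exists>f. f \<in> E \<and> q = T f" if q: "q \<in> Q" for q
  proof -
    obtain h where h: "q = (\<Inter>s\<in>F. h s)" "\<forall>s\<in>F. h s \<in> (\<lambda>A. \<phi> s -` A \<inter> space \<mu>) ` \<P>"
      using q unfolding Q_def dynamical_join_def big_family_join_def pullback_def mem_Collect_eq
      by blast
    from h(2) have "\<forall>s\<in>F. \<exists>A. A \<in> \<P> \<and> h s = \<phi> s -` A \<inter> space \<mu>" by blast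
    from bchoice[OF this] obtain f where f: "\<forall>s\<in>F. f s \<in> \<P> \<and> h s = \<phi> s -` f s \<inter> space \<mu>"
      by blast
    then have "restrict f F \<in> E" "q = T (restrict f F)" using h(1) by (auto simp: E_def T_def)
    then show ?thesis by blast
  qed
  \<comment> \<open>Several names may describe the same set, namely the empty one. With one name
    chosen for each member of the join, \<open>g\<close> is injective and the weights
    \<open>w (g q)\<close> sum to at most 1.\<close>
  define g where "g q = (SOME f. f \<in> E \<and> q = T f)" for q
  have g: "g q \<in> E" "q = T (g q)" if "q \<in> Q" for q
    using someI_ex[OF Q[OF that]] unfolding g_def by blast+
  have TQ: "T f \<in> Q" if "f \<in> E" for f
  proof -
    have "\<forall>s\<in>F. \<phi> s -` f s \<inter> space \<mu> \<in> (\<lambda>A. \<phi> s -` A \<inter> space \<mu>) ` \<P>"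
      using that unfolding E_def by blast
    then show ?thesis
      unfolding Q_def dynamical_join_def big_family_join_def pullback_def T_def by blast
  qed
  have inj: "inj_on g Q" using g(2) by (intro inj_onI) metis
  have finQ: "finite Q" using inj g(1) finE by (meson finite_imageD finite_subset image_subsetI)
  have memT: "x \<in> space \<mu> \<and> (\<forall>s\<in>F. \<phi> s x \<in> f s)" if "x \<in> T f" for x f
    using that F_ne unfolding T_def by blast
  have Q_sets: "q \<in> sets \<mu>" if q: "q \<in> Q" for q
  proof -
    have "\<phi> s -` g q s \<inter> space \<mu> \<in> sets \<mu>" if "s \<in> F" for s
      using measurable_sets[OF meas[OF that]] P(2) g(1)[OF q] that unfolding E_def by blast
    then have "T (g q) \<in> sets \<mu>"
      unfolding T_def using F F_ne by (intro sets.finite_INT) auto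
    then show ?thesis using g(2)[OF q] by simp
  qed
  have Q_disj: "q = q'" if "q \<in> Q" "q' \<in> Q" "x \<in> q" "x \<in> q'" for q q' x
  proof -
    have "g q s = g q' s" if s: "s \<in> F" for s
    proof -
      have "\<phi> s x \<in> g q s" "\<phi> s x \<in> g q' s"
        using memT s g(2) \<open>q \<in> Q\<close> \<open>q' \<in> Q\<close> \<open>x \<in> q\<close> \<open>x \<in> q'\<close> by blast+
      moreover have "g q s \<in> \<P>" "g q' s \<in> \<P>"
        using g(1) s \<open>q \<in> Q\<close> \<open>q' \<in> Q\<close> unfolding E_def by blast+
      ultimately show ?thesis using P_unique by blast
    qed
    then have "T (g q) = T (g q')" by (simp add: T_def)
    then show ?thesis using g(2) that by metis
  qed
  have Q_cover: "\<Union>Q = space \<mu>"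
  proof (intro equalityI subsetI)
    fix x assume "x \<in> \<Union>Q" then show "x \<in> space \<mu>" using Q_sets sets.sets_into_space by blast
  next
    fix x assume x: "x \<in> space \<mu>"
    have "\<forall>s\<in>F. \<exists>A. A \<in> \<P> \<and> \<phi> s x \<in> A"
      using measurable_space[OF meas x] P_cover by blast
    from bchoice[OF this] obtain f where f: "\<forall>s\<in>F. f s \<in> \<P> \<and> \<phi> s x \<in> f s" by blast
    then have "restrict f F \<in> E" "x \<in> T (restrict f F)" using x by (auto simp: E_def T_def)
    then show "x \<in> \<Union>Q" using TQ by blast
  qed
  have "(\<Sum>q\<in>Q. prob q) = prob (\<Union>q\<in>Q. q)"
    using finQ Q_sets Q_disj
    by (intro finite_measure_finite_Union[symmetric]) (auto simp: disjoint_family_on_def)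
  also have "\<dots> = 1" using Q_cover prob_space by simp
  finally have Q_sum: "(\<Sum>q\<in>Q. prob q) = 1" .
  have "(\<Sum>q\<in>Q. w (g q)) = (\<Sum>f\<in>g ` Q. w f)" using inj by (simp add: sum.reindex)
  also have "\<dots> \<le> (\<Sum>f\<in>E. w f)"
    using finE g(1) w_pos by (intro sum_mono2) (auto intro: less_imp_le)
  finally have wQ: "(\<Sum>q\<in>Q. w (g q)) \<le> (\<Sum>q\<in>Q. prob q)" using w_sum Q_sum by simp
  \<comment> \<open>A pointwise bound on code length: the cost of naming some \<open>W\<close>
    containing \<open>x\<close>, a small cost at each time, and the penalty \<open>L\<close> at the
    times when the orbit visits \<open>B\<close>.\<close>
  define b where "b x = ln (real (card \<V>)) +
      (\<Sum>s\<in>F. - ln (1 - \<eta>) + L * indicator (\<phi> s -` B \<inter> space \<mu>) x)" for x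
  have b_ge: "- ln (w (g q)) \<le> b x" if q: "q \<in> Q" and x: "x \<in> q" for q x
  proof -
    have xT: "x \<in> T (g q)" using g(2)[OF q] x by simp
    have xs: "x \<in> space \<mu>" using memT[OF xT] by simp
    then obtain W where W: "W \<in> \<V>" "x \<in> W" using V(2) by blast
    have prod: "(\<Prod>s\<in>F. r W s (g q s)) > 0" using r_pos by (simp add: prod_pos)
    then have "ln ((\<Prod>s\<in>F. r W s (g q s)) / real (card \<V>)) \<le> ln (w (g q))"
      using w_ge[OF W(1)] cV by (intro ln_mono divide_pos_pos) auto
    moreover have "ln ((\<Prod>s\<in>F. r W s (g q s)) / real (card \<V>)) =
        (\<Sum>s\<in>F. ln (r W s (g q s))) - ln (real (card \<V>))"
      using cV prod ln_prod[OF F, of "\<lambda>s. r W s (g q s)"] order_less_imp_not_eq2[OF r_pos]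
      by (simp add: ln_div)
    ultimately have "- ln (w (g q)) \<le> ln (real (card \<V>)) + (\<Sum>s\<in>F. - ln (r W s (g q s)))"
      by (simp add: sum_negf)
    also have "\<dots> \<le> b x"
      unfolding b_def
    proof (intro add_left_mono sum_mono)
      fix s assume s: "s \<in> F"
      show "- ln (r W s (g q s)) \<le> - ln (1 - \<eta>) + L * indicator (\<phi> s -` B \<inter> space \<mu>) x"
      proof (cases "\<phi> s x \<in> B")
        case True
        have "ln (\<eta> / k) \<le> ln (r W s (g q s))"
          using \<eta> k by (intro ln_mono) (auto simp: r_def)
        moreover have "ln (\<eta> / k) = - L" using \<eta> k by (simp add: L_def ln_div)
        moreover have "ln (1 - \<eta>) \<le> 0" using \<eta> by simp
        ultimately show ?thesis using True xs by simp
      next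
        case False
        have "\<phi> s x \<in> u W s" using good[OF W(1) s W(2) False] .
        moreover have "\<phi> s x \<in> g q s" using memT[OF xT] s by blast
        moreover have "g q s \<in> \<P>" using g(1)[OF q] s unfolding E_def by blast
        ultimately have "g q s = u W s" using P_unique u[OF W(1) s] by blast
        then have "ln (1 - \<eta>) \<le> ln (r W s (g q s))"
          using \<eta> k by (intro ln_mono) (auto simp: r_def)
        then show ?thesis using False by simp
      qed
    qed
    finally show ?thesis .
  qed
  have mB: "\<phi> s -` B \<inter> space \<mu> \<in> sets \<mu>" if "s \<in> F" for s
    using measurable_sets[OF meas[OF that] B(1)] .
  have int: "integrable \<mu> (indicator A :: _ \<Rightarrow> real)" if "A \<in> sets \<mu>" for A
    using that by (simp add: emeasure_eq_measure)
  have int_b: "integrable \<mu> b"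
    unfolding b_def     by (intro Bochner_Integration.integrable_add Bochner_Integration.integrable_sum
        integrable_mult_right integrable_const int mB)
  have "shannon_entropy \<mu> Q \<le> (\<Sum>q\<in>Q. prob q * - ln (w (g q)))"
    unfolding shannon_entropy_def using w_pos wQ by (intro Gibbs_inequality) simp_all
  \<comment> \<open>Passing to integrals allows the pointwise bound to be used: \<open>Q\<close>
    partitions the space, so exactly one summand is active at each point.\<close>
  also have "\<dots> = (\<Sum>q\<in>Q. \<integral>x. - ln (w (g q)) * indicator q x \<partial>\<mu>)"
    using Q_sets by (intro sum.cong) (auto simp: sets.Int_space_eq2)
  also have "\<dots> = (\<integral>x. (\<Sum>q\<in>Q. - ln (w (g q)) * indicator q x) \<partial>\<mu>)"
    by (intro Bochner_Integration.integral_sum[symmetric] integrable_mult_right int Q_sets)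
  also have "\<dots> \<le> (\<integral>x. b x \<partial>\<mu>)"
  proof (rule integral_mono)
    show "integrable \<mu> (\<lambda>x. \<Sum>q\<in>Q. - ln (w (g q)) * indicator q x)"
      by (intro Bochner_Integration.integrable_sum integrable_mult_right int Q_sets)
    fix x assume "x \<in> space \<mu>"
    then obtain q where q: "q \<in> Q" "x \<in> q" using Q_cover by blast
    have "(\<Sum>q'\<in>Q. - ln (w (g q')) * indicator q' x) = (\<Sum>q'\<in>Q. if q' = q then - ln (w (g q)) else 0)"
    proof (rule sum.cong[OF refl])
      fix q' assume "q' \<in> Q"
      then have "x \<in> q' \<longleftrightarrow> q' = q" using Q_disj q by blast
      then show "- ln (w (g q')) * indicator q' x = (if q' = q then - ln (w (g q)) else 0)"
        by (simp add: indicator_def)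
    qed
    also have "\<dots> \<le> b x" using b_ge[OF q] finQ q(1) by simp
    finally show "(\<Sum>q\<in>Q. - ln (w (g q)) * indicator q x) \<le> b x" .
  qed (rule int_b)
  also have "\<dots> = ln (real (card \<V>)) + (\<Sum>s\<in>F. - ln (1 - \<eta>) + L * prob B)"
  proof -
    have "(\<integral>x. b x \<partial>\<mu>) = (\<integral>x. ln (real (card \<V>)) \<partial>\<mu>) +
        (\<integral>x. (\<Sum>s\<in>F. - ln (1 - \<eta>) + L * indicator (\<phi> s -` B \<inter> space \<mu>) x) \<partial>\<mu>)"
      unfolding b_def       by (intro Bochner_Integration.integral_add Bochner_Integration.integrable_add
          Bochner_Integration.integrable_sum integrable_mult_right integrable_const int mB)
    also have "(\<integral>x. (\<Sum>s\<in>F. - ln (1 - \<eta>) + L * indicator (\<phi> s -` B \<inter> space \<mu>) x) \<partial>\<mu>) =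
        (\<Sum>s\<in>F. \<integral>x. - ln (1 - \<eta>) + L * indicator (\<phi> s -` B \<inter> space \<mu>) x \<partial>\<mu>)"
            by (intro Bochner_Integration.integral_sum Bochner_Integration.integrable_add
          integrable_mult_right integrable_const int mB)
    also have "\<dots> = (\<Sum>s\<in>F. - ln (1 - \<eta>) + L * prob B)"
    proof (rule sum.cong[OF refl])
      fix s assume s: "s \<in> F"
      have "(\<integral>x. - ln (1 - \<eta>) + L * indicator (\<phi> s -` B \<inter> space \<mu>) x \<partial>\<mu>) =
          (\<integral>x. - ln (1 - \<eta>) \<partial>\<mu>) + (\<integral>x. L * indicator (\<phi> s -` B \<inter> space \<mu>) x \<partial>\<mu>)"
        using s
        by (intro Bochner_Integration.integral_add integrable_mult_right integrable_const int mB)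
      then show "(\<integral>x. - ln (1 - \<eta>) + L * indicator (\<phi> s -` B \<inter> space \<mu>) x \<partial>\<mu>) =
          - ln (1 - \<eta>) + L * prob B"
        using B(2)[OF s] prob_space by simp
    qed
    finally show ?thesis using prob_space by simp
  qed
  finally show ?thesis by (simp add: Q_def L_def k_def)
qed

lemma (in prob_space) shannon_entropy_nonneg: "0 \<le> shannon_entropy M \<Q>"
proof -
  have "prob q * ln (prob q) \<le> 0" for q
    by (cases "prob q = 0") (auto intro!: mult_nonneg_nonpos simp: zero_less_measure_iff)
  then show ?thesis unfolding shannon_entropy_def by (simp add: sum_nonpos)
qed

section \<open>Vanishing of the naive measure entropy\<close>

context compact_metric_action
begin

lemma measurable_action:
  assumes "borel_prob_measure mtopology \<mu>" and s: "s \<in> carrier G"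
  shows "\<phi> s \<in> measurable \<mu> \<mu>"
proof (rule measurable_sigma_sets)
  have sp: "space \<mu> = M" and sets: "sets \<mu> = sigma_sets M {U. openin mtopology U}"
    using assms(1) by (simp_all add: borel_prob_measure_def)
  show "sets \<mu> = sigma_sets M {U. openin mtopology U}" by (rule sets)
  show "{U. openin mtopology U} \<subseteq> Pow M" using openin_subset by fastforce
  show "\<phi> s \<in> space \<mu> \<rightarrow> M" using mem_M[OF s] sp by blast
  fix U assume "U \<in> {U. openin mtopology U}"
  then have "openin mtopology {x \<in> topspace mtopology. \<phi> s x \<in> U}"
    using openin_continuous_map_preimage[OF continuous[OF s]] by blast
  then have "{x \<in> M. \<phi> s x \<in> U} \<in> sets \<mu>" using sets by simp
  moreover have "\<phi> s -` U \<inter> space \<mu> = {x \<in> M. \<phi> s x \<in> U}" using sp by blast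
  ultimately show "\<phi> s -` U \<inter> space \<mu> \<in> sets \<mu>" by simp
qed

text \<open>A measurable partition is not an open cover, so each \<open>A\<close> in
  \<open>\<P>\<close> is shrunk to a closed \<open>C A\<close>, and the small losses form
  \<open>B\<close>. The sets that avoid all the other closed cores make up an open cover, and
  outside \<open>B\<close> such a set determines the member of \<open>\<P>\<close>. The bound
  \<open>\<epsilon>\<close> is split into thirds: the size of \<open>\<V>\<close>, the cost of
  correct predictions, and the penalty for visits to \<open>B\<close>.\<close>

lemma ex_small_shannon_entropy:
  assumes dist: "distal_wrt G mtopology \<phi> d" and inf: "infinite (carrier G)"
    and \<mu>: "borel_prob_measure mtopology \<mu>" and inv: "invariant_measure G \<phi> \<mu>"
    and P: "\<P> \<in> finite_measurable_partitions \<mu>" and "\<epsilon> > 0"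
  obtains F where "F \<in> nonempty_finite_subsets (carrier G)"
    "shannon_entropy \<mu> (dynamical_join (space \<mu>) \<phi> \<P> F) \<le> \<epsilon> * real (card F)"
proof -
  interpret \<mu>: prob_space \<mu> using \<mu> by (simp add: borel_prob_measure_def)
  have sp: "space \<mu> = M" and sets: "sets \<mu> = sigma_sets M {U. openin mtopology U}"
    using \<mu> by (simp_all add: borel_prob_measure_def)
  have part: "partition_on M \<P>" and P': "finite \<P>" "\<And>A. A \<in> \<P> \<Longrightarrow> A \<in> sets \<mu>"
    using P sp by (auto simp: finite_measurable_partitions_def)
  have P_cover: "\<Union>\<P> = M" using partition_onD1[OF part] by simp
  have P_unique: "A = A'" if "A \<in> \<P>" "A' \<in> \<P>" "y \<in> A" "y \<in> A'" for A A' y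
    using disjointD[OF partition_onD2[OF part]] that by blast
  define k where "k = real (card \<P>)"
  have "\<P> \<noteq> {}" using P_cover \<mu>.not_empty sp by auto
  then have k: "k \<ge> 1" using P'(1) by (simp add: k_def Suc_le_eq card_gt_0_iff)
  \<comment> \<open>Chosen so that \<open>- ln (1 - \<eta>)\<close> is exactly
    \<open>\<epsilon> / 3\<close>. The penalty \<open>L\<close> is then fixed before
    \<open>\<tau>\<close>, so that the measure of \<open>B\<close> can be made small relative to
    it.\<close>
  define \<eta> where "\<eta> = 1 - exp (- \<epsilon> / 3)"
  have \<eta>: "0 < \<eta>" "\<eta> < 1" "- ln (1 - \<eta>) = \<epsilon> / 3" using \<open>\<epsilon> > 0\<close> by (simp_all add: \<eta>_def)
  define L where "L = ln (k / \<eta>)"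
  have L: "L \<ge> 0" using k \<eta> by (simp add: L_def)
  \<comment> \<open>The \<open>k\<close> losses have total measure at most
    \<open>k * \<tau>\<close>; with \<open>L + 1\<close> as divisor, \<open>L \<ge> 0\<close> is
    enough for the quotient to be positive.\<close>
  define \<tau> where "\<tau> = \<epsilon> / (3 * (k * (L + 1)))"
  have \<tau>: "\<tau> > 0" using \<open>\<epsilon> > 0\<close> k L by (simp add: \<tau>_def)
  have "\<exists>C. closedin mtopology C \<and> C \<subseteq> A \<and> measure \<mu> (A - C) < \<tau>" if A: "A \<in> \<P>" for A
  proof -
    obtain C U where CU: "closedin mtopology C" "openin mtopology U" "C \<subseteq> A" "A \<subseteq> U"
        "measure \<mu> (U - C) < \<tau>"
      using ex_closed_open_approximation[of mtopology \<mu> A \<tau>] metrizable_space_mtopology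
        \<mu>.finite_measure_axioms sp sets P'(2)[OF A] \<tau> by auto
    have "U \<in> sets \<mu>" using CU(2) sets by auto
    moreover have "M - C \<in> sets \<mu>" using CU(1) sets by (auto simp: closedin_def)
    moreover have "U - C = U \<inter> (M - C)" using openin_subset[OF CU(2)] by auto
    ultimately have "U - C \<in> sets \<mu>" by simp
    then have "measure \<mu> (A - C) \<le> measure \<mu> (U - C)"
      using CU(4) by (intro \<mu>.finite_measure_mono) auto
    then show ?thesis using CU by (intro exI[of _ C]) simp
  qed
  then obtain C where C: "\<And>A. A \<in> \<P> \<Longrightarrow> closedin mtopology (C A)" "\<And>A. A \<in> \<P> \<Longrightarrow> C A \<subseteq> A"
      "\<And>A. A \<in> \<P> \<Longrightarrow> measure \<mu> (A - C A) < \<tau>"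
    by metis
  have C_sets: "A - C A \<in> sets \<mu>" if A: "A \<in> \<P>" for A
  proof -
    have "M - C A \<in> sets \<mu>" using C(1)[OF A] sets by (auto simp: closedin_def)
    moreover have "A - C A = A \<inter> (M - C A)" using A P_cover by blast
    ultimately show ?thesis using P'(2)[OF A] by simp
  qed
  define B where "B = (\<Union>A\<in>\<P>. A - C A)"
  have B: "B \<in> sets \<mu>" unfolding B_def using P'(1) C_sets by (intro sets.finite_UN) auto
  have "measure \<mu> B \<le> (\<Sum>A\<in>\<P>. measure \<mu> (A - C A))"
    unfolding B_def using P'(1) C_sets by (rule measure_UNION_le)
  also have "\<dots> \<le> (\<Sum>A\<in>\<P>. \<tau>)" using C(3) by (intro sum_mono less_imp_le)
  also have "\<dots> = k * \<tau>" by (simp add: k_def)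
  finally have "L * measure \<mu> B \<le> (L + 1) * (k * \<tau>)"
    using L by (intro mult_mono) auto
  also have "\<dots> = (k * (L + 1)) * (\<epsilon> / (3 * (k * (L + 1))))" by (simp add: \<tau>_def mult_ac)
  also have "\<dots> = \<epsilon> / 3"
  proof -
    have "c * (\<epsilon> / (3 * c)) = \<epsilon> / 3" if "c > 0" for c using that by simp
    moreover have "k * (L + 1) > 0" using k L by simp
    ultimately show ?thesis by blast
  qed
  finally have LB: "L * measure \<mu> B \<le> \<epsilon> / 3" .
  define avoid where "avoid A = M - (\<Union>A'\<in>\<P> - {A}. C A')" for A
  have "avoid ` \<P> \<in> finite_open_covers mtopology"
  proof -
    have "openin mtopology (avoid A)" if "A \<in> \<P>" for A
    proof -
      have "closedin mtopology (\<Union>A'\<in>\<P> - {A}. C A')"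
        using P'(1) C(1) by (intro closedin_Union) auto
      then show ?thesis by (simp add: avoid_def closedin_def)
    qed
    moreover have "\<Union>(avoid ` \<P>) = M"
    proof (intro equalityI subsetI)
      fix x assume "x \<in> M"
      then obtain A where A: "A \<in> \<P>" "x \<in> A" using P_cover by blast
      then have "x \<in> avoid A" unfolding avoid_def using \<open>x \<in> M\<close> P_unique[OF A(1) _ A(2)] C(2) by blast
      then show "x \<in> \<Union>(avoid ` \<P>)" using A(1) by blast
    qed (auto simp: avoid_def)
    ultimately show ?thesis using P'(1) by (auto simp: finite_open_covers_def)
  qed
  moreover have "\<epsilon> / 3 > 0" using \<open>\<epsilon> > 0\<close> by simp
  ultimately obtain F \<V> u where F: "F \<in> nonempty_finite_subsets (carrier G)"
    and V: "finite \<V>" "\<Union>\<V> = M" "real (card \<V>) \<le> exp (\<epsilon> / 3 * real (card F))"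
    and u: "\<And>W s. W \<in> \<V> \<Longrightarrow> s \<in> F \<Longrightarrow> u W s \<in> avoid ` \<P>"
      "\<And>W s. W \<in> \<V> \<Longrightarrow> s \<in> F \<Longrightarrow> \<phi> s ` W \<subseteq> u W s"
    by (rule ex_small_refinement[OF dist inf]) (rule that; assumption)
  have F': "finite F" "F \<noteq> {}" "F \<subseteq> carrier G"
    using F by (auto simp: nonempty_finite_subsets_def)
  \<comment> \<open>The prediction is translated from the open cover back to the partition, as the
    coding bound requires. Any label of the same open set will do.\<close>
  define v where "v W s = (SOME A. A \<in> \<P> \<and> u W s = avoid A)" for W s
  have v: "v W s \<in> \<P>" "u W s = avoid (v W s)" if "W \<in> \<V>" "s \<in> F" for W s
  proof -
    have "\<exists>A. A \<in> \<P> \<and> u W s = avoid A" using u(1)[OF that] by blast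
    from someI_ex[OF this] show "v W s \<in> \<P>" "u W s = avoid (v W s)" unfolding v_def by blast+
  qed
  have good: "\<phi> s x \<in> v W s" if W: "W \<in> \<V>" and s: "s \<in> F" and x: "x \<in> W" "\<phi> s x \<notin> B" for W s x
  proof -
    have O: "\<phi> s x \<in> avoid (v W s)" using u(2)[OF W s] v(2)[OF W s] x(1) by blast
    then have "\<phi> s x \<in> M" by (simp add: avoid_def)
    then obtain A where A: "A \<in> \<P>" "\<phi> s x \<in> A" using P_cover by blast
    then have "\<phi> s x \<in> C A" using x(2) by (auto simp: B_def)
    \<comment> \<open>The point lies in the core \<open>C A\<close>, and
      \<open>avoid (v W s)\<close> excludes the cores of all members other than
      \<open>v W s\<close>.\<close>
    then have "A = v W s" using O A(1) by (auto simp: avoid_def)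
    then show ?thesis using A(2) by simp
  qed
  have B_inv: "measure \<mu> (\<phi> s -` B \<inter> space \<mu>) = measure \<mu> B" if "s \<in> F" for s
    using inv B F'(3) that by (auto simp: invariant_measure_def measure_def)
  have meas: "\<phi> s \<in> measurable \<mu> \<mu>" if "s \<in> F" for s
    using measurable_action[OF \<mu>] F'(3) that by blast
  have "\<V> \<noteq> {}" using V(2) \<mu>.not_empty sp by auto
  then have cV: "card \<V> > 0" using V(1) by (simp add: card_gt_0_iff)
  have "shannon_entropy \<mu> (dynamical_join (space \<mu>) \<phi> \<P> F) \<le>
      ln (real (card \<V>)) + real (card F) * (- ln (1 - \<eta>) + ln (real (card \<P>) / \<eta>) * measure \<mu> B)"
    by (rule shannon_entropy_dynamical_join_le[OF \<mu>.prob_space_axioms P F'(1) V(1) _ \<eta>(1,2) meas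
          v(1) B B_inv good F'(2)])
      (simp_all add: V(2) sp)
  also have "\<dots> \<le> \<epsilon> / 3 * real (card F) + real (card F) * (\<epsilon> / 3 + \<epsilon> / 3)"
  proof (intro add_mono mult_left_mono)
    have "ln (real (card \<V>)) \<le> ln (exp (\<epsilon> / 3 * real (card F)))"
      using V(3) cV by (intro ln_mono) auto
    then show "ln (real (card \<V>)) \<le> \<epsilon> / 3 * real (card F)" by simp
  qed (use \<eta>(3) LB in \<open>simp_all add: L_def k_def\<close>)
  also have "\<dots> = \<epsilon> * real (card F)" by (simp add: field_simps)
  finally show ?thesis using that F by blast
qed

lemma naive_measure_entropy_eq_0:
  assumes "distal_wrt G mtopology \<phi> d" and "infinite (carrier G)"
    and \<mu>: "borel_prob_measure mtopology \<mu>" and inv: "invariant_measure G \<phi> \<mu>"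
  shows "naive_measure_entropy G \<mu> \<phi> = 0"
proof (rule antisym)
  interpret \<mu>: prob_space \<mu> using \<mu> by (simp add: borel_prob_measure_def)
  let ?h = "\<lambda>\<P> F. ereal (shannon_entropy \<mu> (dynamical_join (space \<mu>) \<phi> \<P> F) / real (card F))"
  show "naive_measure_entropy G \<mu> \<phi> \<le> 0"
    unfolding naive_measure_entropy_def
  proof (rule SUP_least)
    fix \<P> assume P: "\<P> \<in> finite_measurable_partitions \<mu>"
    show "(INF F\<in>nonempty_finite_subsets (carrier G). ?h \<P> F) \<le> 0"
    proof (rule ereal_le_epsilon2)
      fix \<epsilon> :: real assume "\<epsilon> > 0"
      obtain F where F: "F \<in> nonempty_finite_subsets (carrier G)"
          "shannon_entropy \<mu> (dynamical_join (space \<mu>) \<phi> \<P> F) \<le> \<epsilon> * real (card F)"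
        by (rule ex_small_shannon_entropy[OF assms P \<open>\<epsilon> > 0\<close>])
      have "card F > 0" using F(1) by (auto simp: nonempty_finite_subsets_def card_gt_0_iff)
      then have "?h \<P> F \<le> 0 + ereal \<epsilon>" using F(2) by (simp add: divide_le_eq)
      then show "(INF F\<in>nonempty_finite_subsets (carrier G). ?h \<P> F) \<le> 0 + ereal \<epsilon>"
        by (rule INF_lower2[OF F(1)])
    qed
  qed
  \<comment> \<open>The trivial partition makes the supremum range over a nonempty family; its one
    part is nonempty because \<open>\<mu>\<close> is a probability measure.\<close>
  have "{space \<mu>} \<in> finite_measurable_partitions \<mu>"
    using \<mu>.not_empty by (auto simp: finite_measurable_partitions_def partition_on_def)
  moreover have "0 \<le> (INF F\<in>nonempty_finite_subsets (carrier G). ?h {space \<mu>} F)"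
  proof (rule INF_greatest)
    fix F :: "'a set"
    have "0 \<le> shannon_entropy \<mu> (dynamical_join (space \<mu>) \<phi> {space \<mu>} F) / real (card F)"
      by (simp add: \<mu>.shannon_entropy_nonneg)
    then show "0 \<le> ?h {space \<mu>} F" by (simp only: zero_ereal_def ereal_less_eq)
  qed
  ultimately show "0 \<le> naive_measure_entropy G \<mu> \<phi>"
    unfolding naive_measure_entropy_def by (rule SUP_upper2)
qed

end

theorem corollary1p2:
  fixes G :: "('g, 'm) monoid_scheme"
    and X :: "'x topology"
    and \<phi> :: "'g \<Rightarrow> 'x \<Rightarrow> 'x"
  assumes "group G" and "countable (carrier G)" and "infinite (carrier G)"
    and "compact_space X" and "metrizable_space X"
    and "continuous_action G X \<phi>"
    and "distal G X \<phi>"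
  shows "naive_top_entropy G X \<phi> = 0 \<and>
    (\<forall>\<mu>. borel_prob_measure X \<mu> \<and> invariant_measure G \<phi> \<mu> \<longrightarrow>
         naive_measure_entropy G \<mu> \<phi> = 0)"
proof -
  \<comment> \<open>The metric witnessing distality serves throughout, so no change of metric is
    involved.\<close>
  obtain \<rho> where \<rho>: "compatible_metric X \<rho>" and dist: "distal_wrt G X \<phi> \<rho>"
    using \<open>distal G X \<phi>\<close> by (auto simp: distal_def)
  have "Metric_space (topspace X) \<rho>" and X: "Metric_space.mtopology (topspace X) \<rho> = X"
    using \<rho> by (simp_all add: compatible_metric_def)
  moreover have "group_action G (topspace X) \<phi>" "\<And>s. s \<in> carrier G \<Longrightarrow> continuous_map X X (\<phi> s)"
    using \<open>continuous_action G X \<phi>\<close> by (simp_all add: continuous_action_def)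
  ultimately interpret compact_metric_action G "topspace X" \<rho> \<phi>
    using \<open>compact_space X\<close>
    by (simp add: compact_metric_action_def compact_metric_action_axioms_def)
  show ?thesis
    using naive_top_entropy_eq_0 naive_measure_entropy_eq_0 dist \<open>infinite (carrier G)\<close>
    unfolding X by blast
qed

end
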